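(* Let $(X,r)$ be an involutive solution. Then the following statements are equivalent: (1) The structure skew brace $G(X,r)$ is a bi-skew brace. (2) The permutation skew brace $\mathcal{G}(X,r)$ is a trivial brace. (3) The retract $\operatorname{Ret}(X,r)$ is a trivial solution.
   Context: A skew brace (meaning skew left brace) is a set $A$ with two group structures $(A,\cdot)$ (the additive group) and $(A,\circ)$ (the multiplicative group) such that $a\circ(b\cdot c)=(a\circ b)\cdot a^{-1}\cdot(a\circ c)$ for all $a,b,c\in A$, where $a^{-1}$ is the inverse of $a$ in $(A,\cdot)$; $\overline{a}$ denotes the inverse of $a$ in $(A,\circ)$. A brace is a skew brace with abelian additive group. A skew brace is trivial if $a\cdot b=a\circ b$ for all $a,b$. A bi-skew brace is a skew brace $(A,\cdot,\circ)$ such that $(A,\circ,\cdot)$ is also a skew brace. The gamma function of $A$ is $\gamma\colon(A,\circ)\to\operatorname{Aut}(A,\cdot)$, $\gamma(a)(b)=a^{-1}\cdot(a\circ b)$. An ideal of $A$ is a subgroup $I$ of $(A,\cdot)$ with $\gamma(a)(I)\subseteq I$ for all $a\in A$ that is normal in both $(A,\cdot)$ and $(A,\circ)$; the quotient $A/I$ is then naturally a skew brace. A solution is a pair $(X,r)$ with $X$ a nonempty set and $r\colon X^2\to X^2$ a bijection with $r_1r_2r_1=r_2r_1r_2$ on $X^3$, where $r_1=r\times\mathrm{id}_X$ and $r_2=\mathrm{id}_X\times r$, that is nondegenerate: writing $r(x,y)=(\sigma_x(y),\tau_y(x))$, all maps $\sigma_x,\tau_x\colon X\to X$ are bijective. It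 is involutive if $r^2=\mathrm{id}$, and trivial if $r(x,y)=(y,x)$ for all $x,y$. A homomorphism of solutions $(X,r)\to(Y,s)$ is a map $f\colon X\to Y$ with $(f\times f)r=s(f\times f)$; its image is a subsolution of $(Y,s)$. Every skew brace $A$ gives a solution $(A,r_A)$ with $r_A(a,b)=\big(\gamma(a)(b),\ \overline{\gamma(a)(b)}\circ a\circ b\big)$. The structure group of a solution $(X,r)$ is the group $(G(X,r),\circ)=\langle X\mid x\circ y=\sigma_x(y)\circ\tau_y(x)\text{ for all }x,y\in X\rangle$; let $\iota\colon X\to G(X,r)$ be the canonical map sending each element to the corresponding generator. It is a known fact that there is a (unique) second group operation $\cdot$ on the set $G(X,r)$ such that $(G(X,r),\cdot,\circ)$ is a skew brace, $\iota(X)$ generates the group $(G(X,r),\cdot)$, and $\iota$ is a homomorphism of solutions $(X,r)\to(G(X,r),r_{G(X,r)})$. The structure skew brace $G(X,r)$ means $(G(X,r),\cdot,\circ)$; it is a brace if and only if $(X,r)$ is involutive. The permutation group of $(X,r)$ is $\mathcal{G}(X,r)=\langle(\sigma_x,\tau_x^{-1})\mid x\in X\rangle\subseteq\operatorname{Perm}(X)\times\operatorname{Perm}(X)$. There is a unique surjective group homomorphism $\pi\colon(G(X,r),\circ)\to\mathcal{G}(X,r)$ with $\pi(\iota(x))=(\sigma_x,\tau_x^{-1})$ for $x\in X$; its kernel is an ideal of the structure skew brace, and $\mathcal{G}(X,r)$ carries the induced skew brace structure making $\pi$ a homomorphism of skew braces. The retract $\operatorname{Ret}(X,r)$ is the image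 of the homomorphism of solutions $\pi\iota\colon(X,r)\to(\mathcal{G}(X,r),r_{\mathcal{G}(X,r)})$; equivalently, it is the solution induced on the set of equivalence classes of $X$ under $x\sim y\iff\sigma_x=\sigma_y$ and $\tau_x=\tau_y$. *)

theory Defs
  imports "HOL-Algebra.Bij" "HOL-Algebra.Generated_Groups"
begin

section \<open>Skew braces\<close>

text \<open>
  A skew brace is a pair of group structures on one carrier: \<open>A\<close> is the additive group
  \<open>(A, \<cdot>)\<close> (not assumed abelian), \<open>M\<close> the multiplicative group \<open>(A, \<circ>)\<close>.
\<close>

locale skew_brace = additive: group A + multiplicative: group M
  for A :: "'a monoid" and M :: "'a monoid" +
  assumes carrier_eq: "carrier M = carrier A"
    and skew_distrib:
      "\<lbrakk>a \<in> carrier A; b \<in> carrier A; c \<in> carrier A\<rbrakk> \<Longrightarrow>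
        a \<otimes>\<^bsub>M\<^esub> (b \<otimes>\<^bsub>A\<^esub> c) = (a \<otimes>\<^bsub>M\<^esub> b) \<otimes>\<^bsub>A\<^esub> inv\<^bsub>A\<^esub> a \<otimes>\<^bsub>A\<^esub> (a \<otimes>\<^bsub>M\<^esub> c)"

definition brace :: "'a monoid \<Rightarrow> 'a monoid \<Rightarrow> bool" where
  "brace A M \<longleftrightarrow> skew_brace A M \<and> comm_group A"

definition bi_skew_brace :: "'a monoid \<Rightarrow> 'a monoid \<Rightarrow> bool" where
  "bi_skew_brace A M \<longleftrightarrow> skew_brace A M \<and> skew_brace M A"

definition trivial_brace :: "'a monoid \<Rightarrow> 'a monoid \<Rightarrow> bool" where
  "trivial_brace A M \<longleftrightarrow>
     brace A M \<and> (\<forall>a\<in>carrier A. \<forall>b\<in>carrier A. a \<otimes>\<^bsub>A\<^esub> b = a \<otimes>\<^bsub>M\<^esub> b)"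

definition gamma :: "'a monoid \<Rightarrow> 'a monoid \<Rightarrow> 'a \<Rightarrow> 'a \<Rightarrow> 'a" where
  "gamma A M a b = inv\<^bsub>A\<^esub> a \<otimes>\<^bsub>A\<^esub> (a \<otimes>\<^bsub>M\<^esub> b)"

definition brace_solution :: "'a monoid \<Rightarrow> 'a monoid \<Rightarrow> 'a \<times> 'a \<Rightarrow> 'a \<times> 'a" where
  "brace_solution A M =
     (\<lambda>(a, b). (gamma A M a b, inv\<^bsub>M\<^esub> (gamma A M a b) \<otimes>\<^bsub>M\<^esub> a \<otimes>\<^bsub>M\<^esub> b))"

section \<open>Solutions\<close>

text \<open>
  The map \<open>r\<close> of a solution is a total HOL function on pairs; only its values on \<open>X \<times> X\<close>
  matter. The notation is \<open>r (x, y) = (sigma r x y, tau r y x)\<close>.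
\<close>

definition sigma :: "('a \<times> 'a \<Rightarrow> 'a \<times> 'a) \<Rightarrow> 'a \<Rightarrow> 'a \<Rightarrow> 'a" where
  "sigma r x y = fst (r (x, y))"

definition tau :: "('a \<times> 'a \<Rightarrow> 'a \<times> 'a) \<Rightarrow> 'a \<Rightarrow> 'a \<Rightarrow> 'a" where
  "tau r y x = snd (r (x, y))"

definition act12 :: "('a \<times> 'a \<Rightarrow> 'a \<times> 'a) \<Rightarrow> 'a \<times> 'a \<times> 'a \<Rightarrow> 'a \<times> 'a \<times> 'a" where
  "act12 r = (\<lambda>(x, y, z). (fst (r (x, y)), snd (r (x, y)), z))"

definition act23 :: "('a \<times> 'a \<Rightarrow> 'a \<times> 'a) \<Rightarrow> 'a \<times> 'a \<times> 'a \<Rightarrow> 'a \<times> 'a \<times> 'a" where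
  "act23 r = (\<lambda>(x, y, z). (x, r (y, z)))"

locale solution =
  fixes X :: "'a set" and r :: "'a \<times> 'a \<Rightarrow> 'a \<times> 'a"
  assumes nonempty: "X \<noteq> {}"
    and bij: "bij_betw r (X \<times> X) (X \<times> X)"
    and braid: "t \<in> X \<times> X \<times> X \<Longrightarrow>
      act12 r (act23 r (act12 r t)) = act23 r (act12 r (act23 r t))"
    and sigma_bij: "x \<in> X \<Longrightarrow> bij_betw (sigma r x) X X"
    and tau_bij: "x \<in> X \<Longrightarrow> bij_betw (tau r x) X X"

definition involutive_solution :: "'a set \<Rightarrow> ('a \<times> 'a \<Rightarrow> 'a \<times> 'a) \<Rightarrow> bool" where
  "involutive_solution X r \<longleftrightarrow> solution X r \<and> (\<forall>p\<in>X \<times> X. r (r p) = p)"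

definition trivial_solution :: "'a set \<Rightarrow> ('a \<times> 'a \<Rightarrow> 'a \<times> 'a) \<Rightarrow> bool" where
  "trivial_solution X r \<longleftrightarrow> solution X r \<and> (\<forall>x\<in>X. \<forall>y\<in>X. r (x, y) = (y, x))"

definition solution_hom ::
  "'a set \<Rightarrow> ('a \<times> 'a \<Rightarrow> 'a \<times> 'a) \<Rightarrow> 'b set \<Rightarrow> ('b \<times> 'b \<Rightarrow> 'b \<times> 'b) \<Rightarrow> ('a \<Rightarrow> 'b) \<Rightarrow> bool" where
  "solution_hom X r Y s f \<longleftrightarrow>
     f \<in> X \<rightarrow> Y \<and> (\<forall>p\<in>X \<times> X. map_prod f f (r p) = s (map_prod f f p))"

section \<open>Groups given by generators and relations\<close>

text \<open>
  A group word over \<open>X\<close> is a list of letters \<open>(x, e)\<close>, where \<open>(x, True)\<close> stands for the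
  generator \<open>x\<close> and \<open>(x, False)\<close> for its formal inverse. The group \<open>\<langle>X | u = v, (u, v) \<in> R\<rangle>\<close> is
  the set of words modulo the least congruence containing the free cancellations and \<open>R\<close>.
\<close>

type_synonym 'a word = "('a \<times> bool) list"

definition words :: "'a set \<Rightarrow> 'a word set" where
  "words X = lists (X \<times> UNIV)"

inductive_set word_rel :: "'a set \<Rightarrow> ('a word \<times> 'a word) set \<Rightarrow> ('a word \<times> 'a word) set"
  for X R where
    refl: "w \<in> words X \<Longrightarrow> (w, w) \<in> word_rel X R"
  | sym: "(u, v) \<in> word_rel X R \<Longrightarrow> (v, u) \<in> word_rel X R"
  | trans: "(u, v) \<in> word_rel X R \<Longrightarrow> (v, w) \<in> word_rel X R \<Longrightarrow> (u, w) \<in> word_rel X R"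
  | append: "(u, v) \<in> word_rel X R \<Longrightarrow> (u', v') \<in> word_rel X R \<Longrightarrow>
      (u @ u', v @ v') \<in> word_rel X R"
  | cancel: "x \<in> X \<Longrightarrow> ([(x, e), (x, \<not> e)], []) \<in> word_rel X R"
  | relator: "(u, v) \<in> R \<Longrightarrow> u \<in> words X \<Longrightarrow> v \<in> words X \<Longrightarrow> (u, v) \<in> word_rel X R"

definition presented_group :: "'a set \<Rightarrow> ('a word \<times> 'a word) set \<Rightarrow> 'a word set monoid" where
  "presented_group X R =
     \<lparr>carrier = words X // word_rel X R,
      mult = (\<lambda>U V. \<Union>u\<in>U. \<Union>v\<in>V. word_rel X R `` {u @ v}),
      one = word_rel X R `` {[]}\<rparr>"

section \<open>The structure skew brace\<close>

definition structure_relations :: "'a set \<Rightarrow> ('a \<times> 'a \<Rightarrow> 'a \<times> 'a) \<Rightarrow> ('a word \<times> 'a word) set" where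
  "structure_relations X r =
     {([(x, True), (y, True)], [(sigma r x y, True), (tau r y x, True)]) | x y. x \<in> X \<and> y \<in> X}"

definition structure_group :: "'a set \<Rightarrow> ('a \<times> 'a \<Rightarrow> 'a \<times> 'a) \<Rightarrow> 'a word set monoid" where
  "structure_group X r = presented_group X (structure_relations X r)"

definition iota :: "'a set \<Rightarrow> ('a \<times> 'a \<Rightarrow> 'a \<times> 'a) \<Rightarrow> 'a \<Rightarrow> 'a word set" where
  "iota X r x = word_rel X (structure_relations X r) `` {[(x, True)]}"

text \<open>
  The additive group of the structure skew brace. A group structure with these properties exists
  for every solution, and its operation is unique on the carrier. Hilbert choice is used instead
  of definite description only because the operation of a \<^typ>\<open>'a monoid\<close> is unconstrained
  outside the carrier.
\<close>

definition structure_add_group :: "'a set \<Rightarrow> ('a \<times> 'a \<Rightarrow> 'a \<times> 'a) \<Rightarrow> 'a word set monoid" where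
  "structure_add_group X r =
     (SOME A. skew_brace A (structure_group X r) \<and>
        generate A (iota X r ` X) = carrier A \<and>
        solution_hom X r (carrier A) (brace_solution A (structure_group X r)) (iota X r))"

section \<open>The permutation skew brace and the retract\<close>

definition perm_generator ::
  "'a set \<Rightarrow> ('a \<times> 'a \<Rightarrow> 'a \<times> 'a) \<Rightarrow> 'a \<Rightarrow> ('a \<Rightarrow> 'a) \<times> ('a \<Rightarrow> 'a)" where
  "perm_generator X r x = (restrict (sigma r x) X, restrict (inv_into X (tau r x)) X)"

definition permutation_group ::
  "'a set \<Rightarrow> ('a \<times> 'a \<Rightarrow> 'a \<times> 'a) \<Rightarrow> (('a \<Rightarrow> 'a) \<times> ('a \<Rightarrow> 'a)) monoid" where
  "permutation_group X r =
     subgroup_generated (BijGroup X \<times>\<times> BijGroup X) (perm_generator X r ` X)"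

text \<open>
  The canonical projection \<open>\<pi>\<close>: such a homomorphism exists, and its values on the carrier are
  unique because \<open>iota X r ` X\<close> generates the structure group.
\<close>

definition permutation_proj ::
  "'a set \<Rightarrow> ('a \<times> 'a \<Rightarrow> 'a \<times> 'a) \<Rightarrow> 'a word set \<Rightarrow> ('a \<Rightarrow> 'a) \<times> ('a \<Rightarrow> 'a)" where
  "permutation_proj X r =
     (SOME f. f \<in> hom (structure_group X r) (permutation_group X r) \<and>
        (\<forall>x\<in>X. f (iota X r x) = perm_generator X r x))"

text \<open>
  The additive operation induced along the surjection \<open>\<pi>\<close>, that is \<open>\<pi> a \<cdot> \<pi> b = \<pi> (a \<cdot> b)\<close>. The
  choice of preimages made by \<^const>\<open>inv_into\<close> is immaterial since the kernel of \<open>\<pi>\<close> is an ideal.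
  The two groups of a skew brace share their identity element.
\<close>

definition permutation_add_group ::
  "'a set \<Rightarrow> ('a \<times> 'a \<Rightarrow> 'a \<times> 'a) \<Rightarrow> (('a \<Rightarrow> 'a) \<times> ('a \<Rightarrow> 'a)) monoid" where
  "permutation_add_group X r =
     (let p = permutation_proj X r;
          lift = inv_into (carrier (structure_group X r)) p
      in \<lparr>carrier = carrier (permutation_group X r),
          mult = (\<lambda>g h. p (lift g \<otimes>\<^bsub>structure_add_group X r\<^esub> lift h)),
          one = \<one>\<^bsub>permutation_group X r\<^esub>\<rparr>)"

text \<open>
  The retract is the image of \<open>\<pi> \<circ> \<iota>\<close>, as a subsolution of the solution of the permutation skew
  brace: its underlying set is \<open>retract_set\<close> and its map is (the restriction of) \<open>retract_map\<close>.
\<close>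

definition retract_set ::
  "'a set \<Rightarrow> ('a \<times> 'a \<Rightarrow> 'a \<times> 'a) \<Rightarrow> (('a \<Rightarrow> 'a) \<times> ('a \<Rightarrow> 'a)) set" where
  "retract_set X r = (permutation_proj X r \<circ> iota X r) ` X"

definition retract_map ::
  "'a set \<Rightarrow> ('a \<times> 'a \<Rightarrow> 'a \<times> 'a) \<Rightarrow>
   (('a \<Rightarrow> 'a) \<times> ('a \<Rightarrow> 'a)) \<times> (('a \<Rightarrow> 'a) \<times> ('a \<Rightarrow> 'a)) \<Rightarrow>
   (('a \<Rightarrow> 'a) \<times> ('a \<Rightarrow> 'a)) \<times> (('a \<Rightarrow> 'a) \<times> ('a \<Rightarrow> 'a))" where
  "retract_map X r = brace_solution (permutation_add_group X r) (permutation_group X r)"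

end

theory Submission
  imports Defs
begin

text \<open>
  Write \<open>G\<close> for the structure brace, \<open>\<pi>\<close> for the projection onto the permutation brace and \<open>\<gamma>\<close> for
  the gamma function of \<open>G\<close>. All three statements are equivalent to one condition:
  \<open>\<pi> (\<gamma>(a)(b)) = \<pi> b\<close> for all \<open>a\<close> and \<open>b\<close> in \<open>G\<close>.

  \<^item> The permutation brace is trivial if and only if \<open>\<pi> (a \<cdot> b) = \<pi> (a \<circ> b)\<close> always. As
    \<open>a \<circ> b = a \<cdot> \<gamma>(a)(b)\<close>, this is the condition (\<open>trivial_brace_permutation_iff\<close>).
  \<^item> A trivial retract gives the condition for generators \<open>a\<close> and \<open>b\<close>. It extends to all \<open>a\<close> because
    \<open>\<gamma>\<close> is an action, and to all \<open>b\<close> because \<open>\<pi>\<close> and \<open>\<gamma>(a)\<close> are additive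
    (\<open>trivial_solution_retract_iff\<close>).
  \<^item> A brace is a bi-skew brace if and only if \<open>\<gamma>(\<gamma>(a)(b)) = \<gamma>(b)\<close> for all \<open>a\<close> and \<open>b\<close>
    (\<open>bi_skew_brace_iff_gamma_invariant\<close>). This is the condition because \<open>\<pi>\<close> and \<open>\<gamma>\<close> have the same
    kernel (\<open>permutation_proj_eq_iff\<close>). Indeed \<open>\<gamma>(a)\<close> permutes the generators \<open>\<iota> x\<close> as the first
    component of \<open>\<pi> a\<close> permutes \<open>X\<close>, the map \<open>\<iota>\<close> is injective for an involutive solution, and the
    second component of \<open>\<pi> a\<close> is conjugate to the first by the diagonal map \<open>x \<mapsto> inv (\<sigma> x) x\<close>.

  The structure brace is specified by its properties, so its existence is part of the proof
  (\<open>structure_add_group\<close>). Instead of a cocycle into a free abelian group, the construction uses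
  permutations of the set \<open>G\<close>: for \<open>x \<in> X\<close>, send \<open>a\<close> to \<open>a \<circ> \<iota> y\<close>, where \<open>a\<close> moves \<open>y\<close> to \<open>x\<close>. The
  defining relations say that these permutations commute; they generate a transitive group; and an
  abelian transitive group acts regularly, so it can be identified with \<open>G\<close> by its action on the
  identity. The left translations of \<open>G\<close> normalize it, which is the law of a skew brace.
\<close>

section \<open>Generated subgroups\<close>

text \<open>
  Each centralizer is a subgroup, so commutation passes from the generators to one argument of the
  product and then to the other.
\<close>

lemma (in group) generate_commute:
  assumes S: "S \<subseteq> carrier G"
    and comm: "\<And>x y. x \<in> S \<Longrightarrow> y \<in> S \<Longrightarrow> x \<otimes> y = y \<otimes> x"
    and a: "a \<in> generate G S" and b: "b \<in> generate G S"
  shows "a \<otimes> b = b \<otimes> a"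
proof -
  have centralizer: "subgroup {x \<in> carrier G. x \<otimes> c = c \<otimes> x} G" if "c \<in> carrier G" for c
  proof (rule subgroupI)
    fix x assume "x \<in> {x \<in> carrier G. x \<otimes> c = c \<otimes> x}"
    then have x: "x \<in> carrier G" and xc: "c \<otimes> x = x \<otimes> c" by auto
    have "inv x \<otimes> c = inv x \<otimes> (c \<otimes> x) \<otimes> inv x"
      using x that by (simp add: m_assoc)
    also have "\<dots> = c \<otimes> inv x"
      unfolding xc using x that by (simp add: m_assoc[symmetric])
    finally show "inv x \<in> {x \<in> carrier G. x \<otimes> c = c \<otimes> x}"
      using x by simp
  next
    fix x y assume "x \<in> {x \<in> carrier G. x \<otimes> c = c \<otimes> x}" "y \<in> {x \<in> carrier G. x \<otimes> c = c \<otimes> x}"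
    then show "x \<otimes> y \<in> {x \<in> carrier G. x \<otimes> c = c \<otimes> x}"
      using that by simp (metis m_assoc)
  qed (use that in \<open>auto intro!: exI[of _ \<one>]\<close>)
  have step: "a' \<otimes> s = s \<otimes> a'" if "s \<in> S" "a' \<in> generate G S" for a' s
    using generate_subgroup_incl[OF _ centralizer, of S s] comm that S by blast
  have "b \<otimes> a = a \<otimes> b"
    using generate_subgroup_incl[OF _ centralizer, of S a] step a b S generate_in_carrier[OF S a]
    by (smt (verit, ccfv_SIG) mem_Collect_eq subset_eq)
  then show ?thesis by simp
qed

lemma hom_eq_on_generate:
  assumes "group G" "group H" "f \<in> hom G H" "h \<in> hom G H" "S \<subseteq> carrier G"
    and eq: "\<And>x. x \<in> S \<Longrightarrow> f x = h x"
    and "a \<in> generate G S"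
  shows "f a = h a"
proof -
  interpret f: group_hom G H f using assms by (simp add: group_hom_def group_hom_axioms_def)
  interpret h: group_hom G H h using assms by (simp add: group_hom_def group_hom_axioms_def)
  show ?thesis
    using assms(7)
  proof induction
    case (eng a b)
    then show ?case using f.G.generate_in_carrier[OF assms(5)] by simp
  qed (use assms(5) eq in \<open>auto simp: subset_iff\<close>)
qed

section \<open>Presented groups\<close>

lemma words_simps [simp]:
  "[] \<in> words X"
  "(l # w) \<in> words X \<longleftrightarrow> fst l \<in> X \<and> w \<in> words X"
  "u @ v \<in> words X \<longleftrightarrow> u \<in> words X \<and> v \<in> words X"
  by (cases l; auto simp: words_def)+

lemma word_rel_words:
  "(u, v) \<in> word_rel X R \<Longrightarrow> u \<in> words X \<and> v \<in> words X"
  by (induction rule: word_rel.induct) auto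

lemma equiv_word_rel: "equiv (words X) (word_rel X R)"
  by (rule equivI)
    (auto simp: refl_on_def intro!: symI transI
      intro: word_rel.refl word_rel.sym word_rel.trans dest: word_rel_words)

lemma word_rel_class_eq_iff:
  assumes "u \<in> words X" "v \<in> words X"
  shows "word_rel X R `` {u} = word_rel X R `` {v} \<longleftrightarrow> (u, v) \<in> word_rel X R"
  using eq_equiv_class_iff[OF equiv_word_rel] assms by blast

lemma presented_group_mult:
  assumes "u \<in> words X" "v \<in> words X"
  shows "word_rel X R `` {u} \<otimes>\<^bsub>presented_group X R\<^esub> word_rel X R `` {v} = word_rel X R `` {u @ v}"
proof -
  have "word_rel X R `` {u' @ v'} = word_rel X R `` {u @ v}"
    if "(u, u') \<in> word_rel X R" "(v, v') \<in> word_rel X R" for u' v'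
    using word_rel.append[OF that] equiv_class_eq[OF equiv_word_rel] by metis
  \<comment> \<open>The union that defines the product is a union of copies of one class.\<close>
  then have "(\<Union>u'\<in>word_rel X R `` {u}. \<Union>v'\<in>word_rel X R `` {v}. word_rel X R `` {u' @ v'})
      = (\<Union>u'\<in>word_rel X R `` {u}. \<Union>v'\<in>word_rel X R `` {v}. word_rel X R `` {u @ v})"
    by (intro SUP_cong refl) auto
  also have "\<dots> = word_rel X R `` {u @ v}"
    using word_rel.refl[OF assms(1)] word_rel.refl[OF assms(2)] by blast
  finally show ?thesis
    unfolding presented_group_def by simp
qed

lemma presented_group_carrierI:
  "u \<in> words X \<Longrightarrow> word_rel X R `` {u} \<in> carrier (presented_group X R)"
  unfolding presented_group_def by (auto intro: quotientI)

lemma presented_group_carrierE: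
  assumes "a \<in> carrier (presented_group X R)"
  obtains u where "u \<in> words X" "a = word_rel X R `` {u}"
  using assms unfolding presented_group_def by (auto elim: quotientE)

lemma presented_group_one: "\<one>\<^bsub>presented_group X R\<^esub> = word_rel X R `` {[]}"
  unfolding presented_group_def by simp

definition inverse_word :: "'a word \<Rightarrow> 'a word" where
  "inverse_word w = rev (map (apsnd Not) w)"

lemma inverse_word:
  assumes "w \<in> words X"
  shows "inverse_word w \<in> words X" "(inverse_word w @ w, []) \<in> word_rel X R"
proof -
  have "inverse_word w \<in> words X \<and> (inverse_word w @ w, []) \<in> word_rel X R"
    using assms
  proof (induction w)
    case (Cons l w)
    obtain x e where l: "l = (x, e)" by force
    let ?v = "inverse_word w"
    have IH: "?v \<in> words X" "(?v @ w, []) \<in> word_rel X R"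
      using Cons by auto
    have "([(x, \<not> e), (x, e)], []) \<in> word_rel X R"
      using word_rel.cancel[of x X "\<not> e"] Cons.prems l by simp
    moreover have "(w, w) \<in> word_rel X R" "(?v, ?v) \<in> word_rel X R"
      using Cons.prems IH(1) by (auto intro: word_rel.refl)
    ultimately have "(?v @ [(x, \<not> e), (x, e)] @ w, ?v @ [] @ w) \<in> word_rel X R"
      by (intro word_rel.append)
    with IH(2) have "(?v @ [(x, \<not> e), (x, e)] @ w, []) \<in> word_rel X R"
      by (auto intro: word_rel.trans)
    then show ?case
      using IH(1) Cons.prems by (simp add: inverse_word_def l)
  qed (auto simp: inverse_word_def intro: word_rel.refl)
  then show "inverse_word w \<in> words X" "(inverse_word w @ w, []) \<in> word_rel X R" by auto
qed

lemma group_presented_group: "group (presented_group X R)"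
proof (rule groupI)
  fix a assume "a \<in> carrier (presented_group X R)"
  then obtain u where u: "u \<in> words X" "a = word_rel X R `` {u}"
    by (rule presented_group_carrierE)
  then show "\<exists>b\<in>carrier (presented_group X R).
      b \<otimes>\<^bsub>presented_group X R\<^esub> a = \<one>\<^bsub>presented_group X R\<^esub>"
    using inverse_word[OF u(1)]
    by (intro bexI[of _ "word_rel X R `` {inverse_word u}"])
      (auto simp: presented_group_mult presented_group_one word_rel_class_eq_iff
        intro: presented_group_carrierI)
qed (auto elim!: presented_group_carrierE
      simp: presented_group_mult presented_group_one presented_group_carrierI)

lemma presented_group_letter_inverse:
  assumes "x \<in> X"
  shows "inv\<^bsub>presented_group X R\<^esub> (word_rel X R `` {[(x, True)]}) = word_rel X R `` {[(x, False)]}"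
proof (rule group.inv_equality[OF group_presented_group])
  have "([(x, False), (x, True)], []) \<in> word_rel X R"
    using word_rel.cancel[OF assms, of False] by simp
  then show "word_rel X R `` {[(x, False)]} \<otimes>\<^bsub>presented_group X R\<^esub> word_rel X R `` {[(x, True)]}
      = \<one>\<^bsub>presented_group X R\<^esub>"
    using assms by (simp add: presented_group_mult presented_group_one word_rel_class_eq_iff)
qed (use assms in \<open>auto intro: presented_group_carrierI\<close>)

lemma generate_presented_group:
  "generate (presented_group X R) ((\<lambda>x. word_rel X R `` {[(x, True)]}) ` X)
    = carrier (presented_group X R)" (is "generate ?G ?S = _")
proof
  show "generate ?G ?S \<subseteq> carrier ?G"
    by (intro group.generate_incl[OF group_presented_group])
      (auto intro: presented_group_carrierI)
  have "word_rel X R `` {w} \<in> generate ?G ?S" if "w \<in> words X" for w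
    using that
  proof (induction w)
    case Nil
    then show ?case using generate.one[of ?G ?S] by (simp add: presented_group_one)
  next
    case (Cons l w)
    obtain x e where l: "l = (x, e)" by force
    with Cons.prems have x: "x \<in> X" "w \<in> words X" by auto
    have "word_rel X R `` {[(x, e)]} \<in> generate ?G ?S"
    proof (cases e)
      case True
      then show ?thesis using x by (auto intro: generate.incl)
    next
      case False
      have "inv\<^bsub>?G\<^esub> (word_rel X R `` {[(x, True)]}) \<in> generate ?G ?S"
        using x by (auto intro: generate.inv)
      with False x show ?thesis by (simp add: presented_group_letter_inverse)
    qed
    from generate.eng[OF this Cons.IH[OF x(2)]] show ?case
      using x by (simp add: presented_group_mult l)
  qed
  then show "carrier ?G \<subseteq> generate ?G ?S"
    by (auto elim: presented_group_carrierE)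
qed

fun word_value :: "('b, 'c) monoid_scheme \<Rightarrow> ('a \<Rightarrow> 'b) \<Rightarrow> 'a word \<Rightarrow> 'b" where
  "word_value H f [] = \<one>\<^bsub>H\<^esub>"
| "word_value H f ((x, e) # w) = (if e then f x else inv\<^bsub>H\<^esub> (f x)) \<otimes>\<^bsub>H\<^esub> word_value H f w"

text \<open>
  The value of a word is constant on the classes of \<open>word_rel\<close>, because the clauses of that relation
  hold in every group in which the relators hold; so a representative may be chosen at will.
\<close>

lemma presented_group_universal:
  assumes "group H" and f: "\<And>x. x \<in> X \<Longrightarrow> f x \<in> carrier H"
    and R: "\<And>u v. (u, v) \<in> R \<Longrightarrow> word_value H f u = word_value H f v"
  shows "\<exists>h \<in> hom (presented_group X R) H. \<forall>x\<in>X. h (word_rel X R `` {[(x, True)]}) = f x"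
proof -
  interpret H: group H by fact
  have closed: "word_value H f w \<in> carrier H" if "w \<in> words X" for w
    using that
  proof (induction w)
    case (Cons l w)
    then show ?case using f by (cases l) auto
  qed simp
  have value_append: "word_value H f (u @ v) = word_value H f u \<otimes>\<^bsub>H\<^esub> word_value H f v"
    if "u \<in> words X" "v \<in> words X" for u v
    using that
  proof (induction u)
    case (Cons l u)
    then show ?case using f closed by (cases l) (auto simp: H.m_assoc)
  qed (use closed in simp)
  have rel: "word_value H f u = word_value H f v" if "(u, v) \<in> word_rel X R" for u v
    using that
  proof induction
    case (append u v u' v')
    then show ?case using word_rel_words value_append by metis
  qed (use f R in auto)
  define h where "h a = word_value H f (SOME u. u \<in> a)" for a
  have h: "h (word_rel X R `` {u}) = word_value H f u" if "u \<in> words X" for u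
  proof -
    have "(SOME u'. u' \<in> word_rel X R `` {u}) \<in> word_rel X R `` {u}"
      using word_rel.refl[OF that] by (intro someI) blast
    then show ?thesis using rel unfolding h_def by fastforce
  qed
  have "h \<in> hom (presented_group X R) H"
    by (rule homI) (auto elim!: presented_group_carrierE simp: presented_group_mult h closed value_append)
  moreover have "\<forall>x\<in>X. h (word_rel X R `` {[(x, True)]}) = f x"
    using f by (simp add: h)
  ultimately show ?thesis by blast
qed

section \<open>Skew braces from abelian permutation groups\<close>

lemma BijGroup_simps [simp]:
  "carrier (BijGroup S) = Bij S"
  "f \<in> Bij S \<Longrightarrow> g \<in> Bij S \<Longrightarrow> f \<otimes>\<^bsub>BijGroup S\<^esub> g = compose S f g"
  "\<one>\<^bsub>BijGroup S\<^esub> = (\<lambda>x\<in>S. x)"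
  by (simp_all add: BijGroup_def)

lemma BijI:
  assumes "f \<in> extensional S" "\<And>x. x \<in> S \<Longrightarrow> f x \<in> S" "\<And>x. x \<in> S \<Longrightarrow> g x \<in> S"
    "\<And>x. x \<in> S \<Longrightarrow> g (f x) = x" "\<And>x. x \<in> S \<Longrightarrow> f (g x) = x"
  shows "f \<in> Bij S"
  using assms by (auto simp: Bij_def intro!: bij_betw_byWitness[where f' = g])

lemma Bij_closed: "f \<in> Bij S \<Longrightarrow> x \<in> S \<Longrightarrow> f x \<in> S"
  using Bij_imp_funcset by blast

lemma BijGroup_inv_apply:
  assumes "f \<in> Bij S" "x \<in> S"
  shows "(inv\<^bsub>BijGroup S\<^esub> f) (f x) = x" "f ((inv\<^bsub>BijGroup S\<^esub> f) x) = x"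
  using assms by (auto simp: inv_BijGroup Bij_closed Bij_def bij_betw_inv_into_left bij_betw_inv_into_right)

lemma Bij_generate_commute:
  assumes Y: "Y \<subseteq> Bij S"
    and comm: "\<And>f g x. f \<in> Y \<Longrightarrow> g \<in> Y \<Longrightarrow> x \<in> S \<Longrightarrow> f (g x) = g (f x)"
    and fg: "f \<in> generate (BijGroup S) Y" "g \<in> generate (BijGroup S) Y" and "x \<in> S"
  shows "f (g x) = g (f x)"
proof -
  interpret B: group "BijGroup S" by (rule group_BijGroup)
  have "f \<otimes>\<^bsub>BijGroup S\<^esub> g = g \<otimes>\<^bsub>BijGroup S\<^esub> f"
  proof (rule B.generate_commute[OF _ _ fg])
    fix f g assume "f \<in> Y" "g \<in> Y"
    then show "f \<otimes>\<^bsub>BijGroup S\<^esub> g = g \<otimes>\<^bsub>BijGroup S\<^esub> f"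
      using Y comm by (auto simp: compose_def subset_iff intro!: restrict_ext)
  qed (use Y in simp)
  moreover have "f \<in> Bij S" "g \<in> Bij S"
    using fg B.generate_incl[of Y] Y by auto
  ultimately show ?thesis
    using \<open>x \<in> S\<close> by (auto dest!: fun_cong[of _ _ x] simp: compose_def)
qed

text \<open>
  An abelian transitive permutation group is regular: a permutation in it is determined by its value
  at \<open>e\<close>, since \<open>f (h e) = h (f e)\<close> and every point has the form \<open>h e\<close>. Evaluation at \<open>e\<close> therefore
  transports the group structure to the set on which it acts.
\<close>

lemma transitive_abelian_comm_group:
  fixes S :: "'a set"
  assumes Y: "Y \<subseteq> Bij S"
    and comm: "\<And>f g x. f \<in> Y \<Longrightarrow> g \<in> Y \<Longrightarrow> x \<in> S \<Longrightarrow> f (g x) = g (f x)"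
    and e: "e \<in> S"
    and trans: "(\<lambda>f. f e) ` generate (BijGroup S) Y = S"
  obtains A :: "'a monoid" where "comm_group A" "carrier A = S" "generate A ((\<lambda>f. f e) ` Y) = S"
    "\<And>f a. f \<in> generate (BijGroup S) Y \<Longrightarrow> a \<in> S \<Longrightarrow> f e \<otimes>\<^bsub>A\<^esub> a = f a"
proof -
  interpret B: group "BijGroup S" by (rule group_BijGroup)
  let ?P = "generate (BijGroup S) Y"
  let ?B = "(BijGroup S)\<lparr>carrier := ?P\<rparr>"
  let ?ev = "\<lambda>f. f e"
  define A where "A = \<lparr>carrier = S, mult = (\<lambda>a. inv_into ?P ?ev a), one = e\<rparr>"
  have P: "?P \<subseteq> Bij S" using B.generate_incl[of Y] Y by simp
  have subgroup: "subgroup ?P (BijGroup S)" using B.generate_is_subgroup[of Y] Y by simp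
  then have "group ?B" by (rule B.subgroup_imp_group)
  have commute: "f (g x) = g (f x)" if "f \<in> ?P" "g \<in> ?P" "x \<in> S" for f g x
    by (rule Bij_generate_commute[OF Y, of f g x]) (use comm that in auto)
  have "comm_group ?B"
  proof (rule group.group_comm_groupI[OF \<open>group ?B\<close>])
    fix f g assume "f \<in> carrier ?B" "g \<in> carrier ?B"
    then show "f \<otimes>\<^bsub>?B\<^esub> g = g \<otimes>\<^bsub>?B\<^esub> f"
      using P commute by (auto simp: compose_def subset_iff intro!: restrict_ext)
  qed
  have inj: "inj_on ?ev ?P"
  proof (rule inj_onI)
    fix f g assume fg: "f \<in> ?P" "g \<in> ?P" "f e = g e"
    have "f x = g x" if x: "x \<in> S" for x
    proof -
      obtain h where "h \<in> ?P" "x = h e" using trans x by blast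
      then show ?thesis using commute[OF _ _ e] fg by metis
    qed
    then show "f = g"
      using fg P by (intro extensionalityI[of f S g]) (auto dest: Bij_imp_extensional)
  qed
  have act: "f e \<otimes>\<^bsub>A\<^esub> a = f a" if "f \<in> ?P" for f a
    using that by (simp add: A_def inv_into_f_f[OF inj])
  have "?ev \<in> hom ?B A"
  proof (rule homI)
    fix f g assume fg: "f \<in> carrier ?B" "g \<in> carrier ?B"
    then show "?ev (f \<otimes>\<^bsub>?B\<^esub> g) = ?ev f \<otimes>\<^bsub>A\<^esub> ?ev g"
      using P e by (subst act) (auto simp: compose_def subset_iff)
  qed (use trans in \<open>auto simp: A_def\<close>)
  then have "comm_group (A\<lparr>carrier := ?ev ` carrier ?B, one := ?ev \<one>\<^bsub>?B\<^esub>\<rparr>)"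
    by (rule comm_group.hom_imp_img_comm_group[OF \<open>comm_group ?B\<close>])
  then have A: "comm_group A"
    using trans e by (simp add: A_def)
  interpret ev: group_hom ?B A ?ev
    using \<open>group ?B\<close> A \<open>?ev \<in> hom ?B A\<close>
    by (simp add: group_hom_def group_hom_axioms_def comm_group.axioms)
  have "generate ?B Y = ?P"
    using B.generate_consistent[OF _ subgroup, of Y] by (auto intro: generate.incl)
  then have "generate A (?ev ` Y) = S"
    using ev.generate_img[of Y] trans by (auto intro: generate.incl)
  with A act show thesis
    by (intro that[of A]) (auto simp: A_def)
qed

text \<open>
  Let an abelian transitive group \<open>P\<close> of permutations of a group \<open>G\<close> be normalized by the left
  translations of \<open>G\<close>, in the sense that \<open>a \<circ> f g = f' (a \<circ> g)\<close> with \<open>f'\<close> the conjugate of \<open>f\<close> by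
  the translation with \<open>a\<close>. Transport \<open>P\<close> to \<open>G\<close> by evaluation at the identity, and let \<open>b\<close> and \<open>c\<close>
  be the images of \<open>f\<close> and \<open>h\<close>. Then \<open>a \<circ> b = f' a\<close> and \<open>a \<circ> c = h' a\<close>, while
  \<open>a \<circ> (b \<cdot> c) = f' (h' a)\<close>; since \<open>f' a\<close> is \<open>f' 1 \<cdot> a\<close>, this is the law of a skew brace.
\<close>

lemma skew_brace_of_abelian_permutations:
  fixes G :: "'a monoid"
  assumes "group G" and Y: "Y \<subseteq> Bij (carrier G)"
    and comm: "\<And>f g x. f \<in> Y \<Longrightarrow> g \<in> Y \<Longrightarrow> x \<in> carrier G \<Longrightarrow> f (g x) = g (f x)"
    and trans: "(\<lambda>f. f \<one>\<^bsub>G\<^esub>) ` generate (BijGroup (carrier G)) Y = carrier G"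
    and normal: "\<And>f a. f \<in> Y \<Longrightarrow> a \<in> carrier G \<Longrightarrow>
      \<exists>f'\<in>Y. \<forall>g\<in>carrier G. a \<otimes>\<^bsub>G\<^esub> f g = f' (a \<otimes>\<^bsub>G\<^esub> g)"
  obtains A where "skew_brace A G" "comm_group A" "carrier A = carrier G"
    "generate A ((\<lambda>f. f \<one>\<^bsub>G\<^esub>) ` Y) = carrier A"
    "\<And>f a. f \<in> Y \<Longrightarrow> a \<in> carrier G \<Longrightarrow> f \<one>\<^bsub>G\<^esub> \<otimes>\<^bsub>A\<^esub> a = f a"
proof -
  interpret G: group G by fact
  let ?S = "carrier G"
  let ?P = "generate (BijGroup ?S) Y"
  interpret B: group "BijGroup ?S" by (rule group_BijGroup)
  have P: "?P \<subseteq> Bij ?S" using B.generate_incl[of Y] Y by simp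
  obtain A :: "'a monoid" where A: "comm_group A" "carrier A = ?S" "generate A ((\<lambda>f. f \<one>\<^bsub>G\<^esub>) ` Y) = ?S"
    and act: "\<And>f a. f \<in> ?P \<Longrightarrow> a \<in> ?S \<Longrightarrow> f \<one>\<^bsub>G\<^esub> \<otimes>\<^bsub>A\<^esub> a = f a"
    by (rule transitive_abelian_comm_group[OF Y _ G.one_closed trans]) (rule comm, assumption+, rule that)
  interpret A: comm_group A by fact
  have normal_P: "\<exists>f'\<in>?P. \<forall>g\<in>?S. a \<otimes>\<^bsub>G\<^esub> f g = f' (a \<otimes>\<^bsub>G\<^esub> g)"
    if "f \<in> ?P" and a: "a \<in> ?S" for f a
    using that(1)
  proof induction
    case one
    have "\<forall>g\<in>?S. a \<otimes>\<^bsub>G\<^esub> \<one>\<^bsub>BijGroup ?S\<^esub> g = \<one>\<^bsub>BijGroup ?S\<^esub> (a \<otimes>\<^bsub>G\<^esub> g)"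
      using a by simp
    then show ?case
      by (intro bexI[of _ "\<one>\<^bsub>BijGroup ?S\<^esub>"] generate.one)
  next
    case (incl f)
    then show ?case using normal[OF incl a] generate.incl[of _ Y "BijGroup ?S"] by blast
  next
    case (inv f)
    let ?i = "m_inv (BijGroup ?S)"
    obtain f' where f': "f' \<in> Y" "\<forall>g\<in>?S. a \<otimes>\<^bsub>G\<^esub> f g = f' (a \<otimes>\<^bsub>G\<^esub> g)"
      using normal[OF inv a] by blast
    have fB: "f \<in> Bij ?S" "f' \<in> Bij ?S" using inv f'(1) Y by auto
    then have iB: "?i f \<in> Bij ?S" using B.inv_closed by simp
    have "a \<otimes>\<^bsub>G\<^esub> ?i f g = ?i f' (a \<otimes>\<^bsub>G\<^esub> g)" if g: "g \<in> ?S" for g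
    proof -
      have "a \<otimes>\<^bsub>G\<^esub> g = f' (a \<otimes>\<^bsub>G\<^esub> ?i f g)"
        using f'(2) BijGroup_inv_apply(2)[OF fB(1) g] Bij_closed[OF iB g] by metis
      then show ?thesis
        using BijGroup_inv_apply(1)[OF fB(2)] Bij_closed[OF iB g] a by simp
    qed
    then show ?case by (intro bexI[OF _ generate.inv[OF f'(1)]] ballI)
  next
    case (eng f h)
    then obtain f' h' where fh': "f' \<in> ?P" "\<forall>g\<in>?S. a \<otimes>\<^bsub>G\<^esub> f g = f' (a \<otimes>\<^bsub>G\<^esub> g)"
      "h' \<in> ?P" "\<forall>g\<in>?S. a \<otimes>\<^bsub>G\<^esub> h g = h' (a \<otimes>\<^bsub>G\<^esub> g)" by blast
    moreover have "f \<in> Bij ?S" "h \<in> Bij ?S" "f' \<in> Bij ?S" "h' \<in> Bij ?S"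
      using eng.hyps fh' P by auto
    ultimately have "\<forall>g\<in>?S. a \<otimes>\<^bsub>G\<^esub> (f \<otimes>\<^bsub>BijGroup ?S\<^esub> h) g
        = (f' \<otimes>\<^bsub>BijGroup ?S\<^esub> h') (a \<otimes>\<^bsub>G\<^esub> g)"
      using a by (simp add: compose_def Bij_closed)
    then show ?case by (rule bexI[OF _ generate.eng[OF fh'(1,3)]])
  qed
  have "skew_brace A G"
  proof (intro skew_brace.intro skew_brace_axioms.intro)
    fix a b c assume "a \<in> carrier A" "b \<in> carrier A" "c \<in> carrier A"
    then have abc: "a \<in> ?S" "b \<in> ?S" "c \<in> ?S" using A(2) by auto
    obtain f h where fh: "f \<in> ?P" "b = f \<one>\<^bsub>G\<^esub>" "h \<in> ?P" "c = h \<one>\<^bsub>G\<^esub>"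
      using trans abc by blast
    obtain f' h' where f': "f' \<in> ?P" "\<forall>g\<in>?S. a \<otimes>\<^bsub>G\<^esub> f g = f' (a \<otimes>\<^bsub>G\<^esub> g)"
      and h': "h' \<in> ?P" "\<forall>g\<in>?S. a \<otimes>\<^bsub>G\<^esub> h g = h' (a \<otimes>\<^bsub>G\<^esub> g)"
      using normal_P[OF fh(1) abc(1)] normal_P[OF fh(3) abc(1)] by blast
    have closed: "f' \<one>\<^bsub>G\<^esub> \<in> carrier A" "h' \<one>\<^bsub>G\<^esub> \<in> carrier A"
      using P f' h' Bij_closed[of _ ?S "\<one>\<^bsub>G\<^esub>"] A(2) by auto
    have b: "a \<otimes>\<^bsub>G\<^esub> b = f' \<one>\<^bsub>G\<^esub> \<otimes>\<^bsub>A\<^esub> a"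
      using f' fh abc by (simp add: act)
    have c: "a \<otimes>\<^bsub>G\<^esub> c = h' \<one>\<^bsub>G\<^esub> \<otimes>\<^bsub>A\<^esub> a"
      using h' fh abc by (simp add: act)
    have "a \<otimes>\<^bsub>G\<^esub> (b \<otimes>\<^bsub>A\<^esub> c) = f' (a \<otimes>\<^bsub>G\<^esub> c)"
      using fh(1,2) f'(2) abc by (simp add: act)
    also have "\<dots> = f' \<one>\<^bsub>G\<^esub> \<otimes>\<^bsub>A\<^esub> (h' \<one>\<^bsub>G\<^esub> \<otimes>\<^bsub>A\<^esub> a)"
      using f' abc by (simp add: act flip: c)
    also have "\<dots> = f' \<one>\<^bsub>G\<^esub> \<otimes>\<^bsub>A\<^esub> a \<otimes>\<^bsub>A\<^esub> inv\<^bsub>A\<^esub> a \<otimes>\<^bsub>A\<^esub> (h' \<one>\<^bsub>G\<^esub> \<otimes>\<^bsub>A\<^esub> a)"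
      using closed abc[folded A(2)] by (simp add: A.m_assoc flip: A.m_assoc[of a "inv\<^bsub>A\<^esub> a"])
    finally show "a \<otimes>\<^bsub>G\<^esub> (b \<otimes>\<^bsub>A\<^esub> c)
        = (a \<otimes>\<^bsub>G\<^esub> b) \<otimes>\<^bsub>A\<^esub> inv\<^bsub>A\<^esub> a \<otimes>\<^bsub>A\<^esub> (a \<otimes>\<^bsub>G\<^esub> c)"
      by (simp add: b c)
  qed (use A(2) in \<open>auto intro: A.is_group G.is_group\<close>)
  then show thesis
    using A by (intro that[of A]) (auto intro!: act intro: generate.incl)
qed

section \<open>Involutive solutions\<close>

locale involutive = solution +
  assumes involutive: "x \<in> X \<Longrightarrow> y \<in> X \<Longrightarrow> r (r (x, y)) = (x, y)"
begin

abbreviation "\<sigma> \<equiv> sigma r"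
abbreviation "\<tau> \<equiv> tau r"

lemma r_eq: "r (x, y) = (\<sigma> x y, \<tau> y x)"
  by (simp add: sigma_def tau_def)

lemma sigma_closed [simp]: "x \<in> X \<Longrightarrow> y \<in> X \<Longrightarrow> \<sigma> x y \<in> X"
  and tau_closed [simp]: "x \<in> X \<Longrightarrow> y \<in> X \<Longrightarrow> \<tau> x y \<in> X"
  using sigma_bij tau_bij by (auto dest: bij_betwE)

lemma sigma_cancel [simp]: "x \<in> X \<Longrightarrow> y \<in> X \<Longrightarrow> z \<in> X \<Longrightarrow> \<sigma> x y = \<sigma> x z \<longleftrightarrow> y = z"
  and tau_cancel [simp]: "x \<in> X \<Longrightarrow> y \<in> X \<Longrightarrow> z \<in> X \<Longrightarrow> \<tau> x y = \<tau> x z \<longleftrightarrow> y = z"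
  using sigma_bij tau_bij by (auto dest!: bij_betw_imp_inj_on dest: inj_onD)

text \<open>
  The outer components of the braid equation. They say that \<open>x \<mapsto> \<sigma> x\<close> and \<open>x \<mapsto> inv (\<tau> x)\<close> respect the
  relations of the structure group.
\<close>

lemma sigma_comp:
  assumes "x \<in> X" "y \<in> X" "z \<in> X"
  shows "\<sigma> x (\<sigma> y z) = \<sigma> (\<sigma> x y) (\<sigma> (\<tau> y x) z)"
  using braid[of "(x, y, z)"] assms by (simp add: act12_def act23_def r_eq)

lemma tau_comp:
  assumes "x \<in> X" "y \<in> X" "z \<in> X"
  shows "\<tau> z (\<tau> y x) = \<tau> (\<tau> z y) (\<tau> (\<sigma> y z) x)"
  using braid[of "(x, y, z)"] assms by (simp add: act12_def act23_def r_eq)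

lemma sigma_tau_involutive:
  assumes "x \<in> X" "y \<in> X"
  shows "\<sigma> (\<sigma> x y) (\<tau> y x) = x" "\<tau> (\<tau> y x) (\<sigma> x y) = y"
  using involutive[OF assms] by (simp_all add: r_eq)

text \<open>
  The diagonal map, often written \<open>T\<close>: the point \<open>diag x\<close> is the unique \<open>y\<close> with \<open>r (x, y) = (x, y)\<close>.
  By the symmetry of that equation, \<open>y \<mapsto> inv_into X (\<tau> y) y\<close> is its inverse.
\<close>

definition diag :: "'a \<Rightarrow> 'a" where
  "diag x = inv_into X (\<sigma> x) x"

lemma sigma_inv [simp]:
  assumes "x \<in> X" "y \<in> X"
  shows "inv_into X (\<sigma> x) y \<in> X" "\<sigma> x (inv_into X (\<sigma> x) y) = y"
proof -
  have "y \<in> \<sigma> x ` X" using bij_betw_imp_surj_on[OF sigma_bij] assms by auto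
  then show "inv_into X (\<sigma> x) y \<in> X" "\<sigma> x (inv_into X (\<sigma> x) y) = y"
    by (auto intro: inv_into_into f_inv_into_f)
qed

lemma tau_inv [simp]:
  assumes "x \<in> X" "y \<in> X"
  shows "inv_into X (\<tau> x) y \<in> X" "\<tau> x (inv_into X (\<tau> x) y) = y"
proof -
  have "y \<in> \<tau> x ` X" using bij_betw_imp_surj_on[OF tau_bij] assms by auto
  then show "inv_into X (\<tau> x) y \<in> X" "\<tau> x (inv_into X (\<tau> x) y) = y"
    by (auto intro: inv_into_into f_inv_into_f)
qed

lemma diag_closed [simp]: "x \<in> X \<Longrightarrow> diag x \<in> X"
  and sigma_diag [simp]: "x \<in> X \<Longrightarrow> \<sigma> x (diag x) = x"
  by (simp_all add: diag_def sigma_inv)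

lemma tau_diag [simp]:
  assumes "x \<in> X" shows "\<tau> (diag x) x = diag x"
  using sigma_tau_involutive(1)[OF assms diag_closed[OF assms]] assms
  by (metis diag_closed sigma_cancel sigma_diag tau_closed)

lemma diag_inj:
  assumes "x \<in> X" "y \<in> X" "diag x = diag y"
  shows "x = y"
  using assms by (metis diag_closed tau_cancel tau_diag)

text \<open>
  Thus \<open>diag\<close> conjugates the inverse of \<open>\<tau> y\<close> into \<open>\<sigma> y\<close>. For this reason \<open>\<tau>\<close> carries no information
  beyond \<open>\<sigma>\<close>.
\<close>

lemma sigma_diag_tau:
  assumes "x \<in> X" "y \<in> X"
  shows "\<sigma> y (diag (\<tau> y x)) = diag x"
proof -
  have "\<sigma> x (\<sigma> y (diag (\<tau> y x))) = \<sigma> (\<sigma> x y) (\<sigma> (\<tau> y x) (diag (\<tau> y x)))"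
    using assms by (intro sigma_comp) auto
  also have "\<dots> = \<sigma> x (diag x)"
    using assms by (simp add: sigma_tau_involutive)
  finally show ?thesis
    using assms sigma_cancel[of x "\<sigma> y (diag (\<tau> y x))" "diag x"] by simp
qed

end

section \<open>The structure group and its permutation representation\<close>

context involutive
begin

abbreviation G :: "'a word set monoid" where
  "G \<equiv> structure_group X r"

abbreviation \<iota> :: "'a \<Rightarrow> 'a word set" where
  "\<iota> \<equiv> iota X r"

abbreviation \<G> :: "(('a \<Rightarrow> 'a) \<times> ('a \<Rightarrow> 'a)) monoid" where
  "\<G> \<equiv> permutation_group X r"

abbreviation \<pi> :: "'a word set \<Rightarrow> ('a \<Rightarrow> 'a) \<times> ('a \<Rightarrow> 'a)" where
  "\<pi> \<equiv> permutation_proj X r"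

sublocale G: group G
  unfolding structure_group_def by (rule group_presented_group)

lemma iota_closed [simp]: "x \<in> X \<Longrightarrow> \<iota> x \<in> carrier G"
  by (auto simp: structure_group_def iota_def intro: presented_group_carrierI)

lemma generate_iota: "generate G (\<iota> ` X) = carrier G"
  unfolding structure_group_def iota_def by (rule generate_presented_group)

lemma iota_relation:
  assumes "x \<in> X" "y \<in> X"
  shows "\<iota> x \<otimes>\<^bsub>G\<^esub> \<iota> y = \<iota> (\<sigma> x y) \<otimes>\<^bsub>G\<^esub> \<iota> (\<tau> y x)"
proof -
  have "([(x, True), (y, True)], [(\<sigma> x y, True), (\<tau> y x, True)])
      \<in> word_rel X (structure_relations X r)"
    using assms by (intro word_rel.relator) (auto simp: structure_relations_def)
  then show ?thesis
    using assms
    by (simp add: structure_group_def iota_def presented_group_mult word_rel_class_eq_iff)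
qed

lemma structure_group_universal:
  assumes "group H" "\<And>x. x \<in> X \<Longrightarrow> f x \<in> carrier H"
    and "\<And>x y. x \<in> X \<Longrightarrow> y \<in> X \<Longrightarrow> f x \<otimes>\<^bsub>H\<^esub> f y = f (\<sigma> x y) \<otimes>\<^bsub>H\<^esub> f (\<tau> y x)"
  shows "\<exists>h\<in>hom G H. \<forall>x\<in>X. h (\<iota> x) = f x"
proof -
  interpret H: group H by fact
  show ?thesis
    unfolding structure_group_def iota_def
  proof (rule presented_group_universal)
    fix u v assume "(u, v) \<in> structure_relations X r"
    then obtain x y where xy: "x \<in> X" "y \<in> X"
      and uv: "u = [(x, True), (y, True)]" "v = [(\<sigma> x y, True), (\<tau> y x, True)]"
      by (auto simp: structure_relations_def)
    then show "word_value H f u = word_value H f v"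
      using assms(3)[OF xy] by (simp add: assms(2))
  qed (use assms in auto)
qed

lemma structure_group_induct [consumes 1, case_names one incl inv eng]:
  assumes "a \<in> carrier G"
    and "P \<one>\<^bsub>G\<^esub>"
    and "\<And>x. x \<in> X \<Longrightarrow> P (\<iota> x)"
    and "\<And>x. x \<in> X \<Longrightarrow> P (\<iota> x) \<Longrightarrow> P (inv\<^bsub>G\<^esub> \<iota> x)"
    and "\<And>a b. a \<in> carrier G \<Longrightarrow> b \<in> carrier G \<Longrightarrow> P a \<Longrightarrow> P b \<Longrightarrow> P (a \<otimes>\<^bsub>G\<^esub> b)"
  shows "P a"
  using assms(1) unfolding generate_iota[symmetric]
proof induction
  case (eng a b)
  then show ?case using assms(5) by (simp add: generate_iota)
qed (use assms in auto)

lemma sigma_inv_sigma [simp]: "x \<in> X \<Longrightarrow> y \<in> X \<Longrightarrow> inv_into X (\<sigma> x) (\<sigma> x y) = y"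
  and tau_inv_tau [simp]: "x \<in> X \<Longrightarrow> y \<in> X \<Longrightarrow> inv_into X (\<tau> x) (\<tau> x y) = y"
  by (simp_all add: bij_betw_inv_into_left[OF sigma_bij] bij_betw_inv_into_left[OF tau_bij])

text \<open>
  The structure group acts on the subsets of \<open>X\<close> by affine maps: the generator \<open>\<iota> x\<close> sends \<open>S\<close> to the
  symmetric difference of \<open>{x}\<close> and \<open>\<sigma> x ` S\<close>. Both sides of the relation for \<open>x\<close> and \<open>y\<close> have
  translation part \<open>{x}\<close> plus \<open>{\<sigma> x y}\<close>, because \<open>r\<close> is involutive, and their linear parts agree
  by the braid equation. The empty set is sent to \<open>{x}\<close>, so
  the generators are distinct. This action is the reduction modulo 2 of the affine action on the
  free abelian group over \<open>X\<close>.
\<close>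

lemma iota_inj: "inj_on \<iota> X"
proof -
  define f where "f x = (\<lambda>S\<in>Pow X. {z\<in>X. (z = x) \<noteq> (inv_into X (\<sigma> x) z \<in> S)})" for x
  \<comment> \<open>Membership is best tested at points written as values of \<open>\<sigma> x\<close>.\<close>
  have f_mem: "\<sigma> x y \<in> f x S \<longleftrightarrow> (\<sigma> x y = x) \<noteq> (y \<in> S)" if "x \<in> X" "y \<in> X" "S \<in> Pow X" for x y S
    using that by (simp add: f_def)
  have f_Pow: "f x S \<in> Pow X" if "S \<in> Pow X" for x S
    using that by (auto simp: f_def)
  have f_Bij: "f x \<in> Bij (Pow X)" if x: "x \<in> X" for x
  proof (rule BijI[where g = "\<lambda>S. {y\<in>X. (\<sigma> x y = x) \<noteq> (\<sigma> x y \<in> S)}"])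
    fix S assume S: "S \<in> Pow X"
    then show "{y\<in>X. (\<sigma> x y = x) \<noteq> (\<sigma> x y \<in> f x S)} = S"
      using x f_mem by auto
    show "f x {y\<in>X. (\<sigma> x y = x) \<noteq> (\<sigma> x y \<in> S)} = S"
      using x S by (auto simp: f_def)
  qed (use f_Pow in \<open>auto simp: f_def\<close>)
  have mem: "\<sigma> x (\<sigma> y w) \<in> f x (f y S) \<longleftrightarrow>
      (\<sigma> x (\<sigma> y w) = x) \<noteq> ((\<sigma> x (\<sigma> y w) = \<sigma> x y) \<noteq> (w \<in> S))"
    if "x \<in> X" "y \<in> X" "w \<in> X" "S \<in> Pow X" for x y w S
    using that f_Pow by (simp add: f_mem)
  have f_comp: "f x (f y S) = f (\<sigma> x y) (f (\<tau> y x) S)" if xy: "x \<in> X" "y \<in> X" and S: "S \<in> Pow X" for x y S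
  proof (rule Set.set_eqI)
    fix z
    show "z \<in> f x (f y S) \<longleftrightarrow> z \<in> f (\<sigma> x y) (f (\<tau> y x) S)"
    proof (cases "z \<in> X")
      case True
      define w where "w = inv_into X (\<sigma> y) (inv_into X (\<sigma> x) z)"
      have w: "w \<in> X" "z = \<sigma> x (\<sigma> y w)"
        using True xy by (auto simp: w_def)
      then have z': "z = \<sigma> (\<sigma> x y) (\<sigma> (\<tau> y x) w)"
        using xy sigma_comp[of x y w] by simp
      show ?thesis
        using mem[of x y w S] mem[of "\<sigma> x y" "\<tau> y x" w S] xy S w(1)
        unfolding w(2)[symmetric] z'[symmetric] by (auto simp: sigma_tau_involutive)
    next
      case False
      then show ?thesis using f_Pow S by blast
    qed
  qed
  have f_rel: "f x \<otimes>\<^bsub>BijGroup (Pow X)\<^esub> f y = f (\<sigma> x y) \<otimes>\<^bsub>BijGroup (Pow X)\<^esub> f (\<tau> y x)"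
    if "x \<in> X" "y \<in> X" for x y
  proof -
    have "compose (Pow X) (f x) (f y) = compose (Pow X) (f (\<sigma> x y)) (f (\<tau> y x))"
      unfolding compose_def by (rule restrict_ext) (rule f_comp[OF that])
    then show ?thesis using that by (simp add: f_Bij)
  qed
  have "\<exists>h\<in>hom G (BijGroup (Pow X)). \<forall>x\<in>X. h (\<iota> x) = f x"
    by (rule structure_group_universal[OF group_BijGroup _ f_rel]) (simp_all add: f_Bij)
  then obtain h where h: "\<forall>x\<in>X. h (\<iota> x) = f x" by blast
  have "f x {} = {x}" if "x \<in> X" for x
    using that by (auto simp: f_def)
  then show ?thesis
    using h by (metis inj_onI singleton_inject)
qed

lemma perm_generator_closed:
  assumes "x \<in> X"
  shows "perm_generator X r x \<in> carrier (BijGroup X \<times>\<times> BijGroup X)"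
  using assms sigma_bij[OF assms] bij_betw_inv_into[OF tau_bij[OF assms]]
  by (simp add: perm_generator_def Bij_def DirProd_def)

lemma perm_generators_closed:
  "perm_generator X r ` X \<subseteq> carrier (BijGroup X \<times>\<times> BijGroup X)"
  by (rule image_subsetI) (rule perm_generator_closed)

lemma perm_generator_relation:
  assumes "x \<in> X" "y \<in> X"
  shows "perm_generator X r x \<otimes>\<^bsub>BijGroup X \<times>\<times> BijGroup X\<^esub> perm_generator X r y
    = perm_generator X r (\<sigma> x y) \<otimes>\<^bsub>BijGroup X \<times>\<times> BijGroup X\<^esub> perm_generator X r (\<tau> y x)"
proof -
  have "inv_into X (\<tau> x) (inv_into X (\<tau> y) z)
      = inv_into X (\<tau> (\<sigma> x y)) (inv_into X (\<tau> (\<tau> y x)) z)" if "z \<in> X" for z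
  proof -
    define v where "v = inv_into X (\<tau> x) (inv_into X (\<tau> y) z)"
    have v: "v \<in> X" "\<tau> y (\<tau> x v) = z"
      using assms that by (auto simp: v_def)
    then have "z = \<tau> (\<tau> y x) (\<tau> (\<sigma> x y) v)"
      using assms tau_comp[of v x y] by simp
    then have "inv_into X (\<tau> (\<sigma> x y)) (inv_into X (\<tau> (\<tau> y x)) z) = v"
      using assms v(1) by simp
    then show ?thesis by (simp add: v_def)
  qed
  then show ?thesis
    using assms sigma_comp[OF assms] perm_generator_closed[of x] perm_generator_closed[of y]
      perm_generator_closed[of "\<sigma> x y"] perm_generator_closed[of "\<tau> y x"]
    by (simp add: perm_generator_def DirProd_def compose_def cong: restrict_cong)
qed

lemma group_DirProd_BijGroup: "group (BijGroup X \<times>\<times> BijGroup X)"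
  by (intro DirProd_group group_BijGroup)

lemma permutation_group_simps:
  "carrier \<G> = generate (BijGroup X \<times>\<times> BijGroup X) (perm_generator X r ` X)"
  "mult \<G> = mult (BijGroup X \<times>\<times> BijGroup X)"
  "\<one>\<^bsub>\<G>\<^esub> = \<one>\<^bsub>BijGroup X \<times>\<times> BijGroup X\<^esub>"
  using perm_generators_closed
  by (simp_all add: permutation_group_def carrier_subgroup_generated Int_absorb1)

sublocale \<G>: group \<G>
  unfolding permutation_group_def by (rule group.group_subgroup_generated[OF group_DirProd_BijGroup])

lemma perm_generator_in_permutation_group: "x \<in> X \<Longrightarrow> perm_generator X r x \<in> carrier \<G>"
  by (auto simp: permutation_group_simps intro: generate.incl)

lemma generate_perm_generator: "generate \<G> (perm_generator X r ` X) = carrier \<G>"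
proof -
  interpret B: group "BijGroup X \<times>\<times> BijGroup X" by (rule group_DirProd_BijGroup)
  have "generate ((BijGroup X \<times>\<times> BijGroup X)\<lparr>carrier := carrier \<G>\<rparr>) (perm_generator X r ` X)
      = carrier \<G>"
    using B.generate_consistent[of "perm_generator X r ` X" "carrier \<G>"]
      B.generate_is_subgroup[OF perm_generators_closed] perm_generator_in_permutation_group
    by (simp add: image_subset_iff flip: permutation_group_simps(1))
  moreover have "(BijGroup X \<times>\<times> BijGroup X)\<lparr>carrier := carrier \<G>\<rparr> = \<G>"
    by (simp add: permutation_group_def subgroup_generated_def)
  ultimately show ?thesis by simp
qed

lemma permutation_proj: "\<pi> \<in> hom G \<G>" "x \<in> X \<Longrightarrow> \<pi> (\<iota> x) = perm_generator X r x"
proof -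
  have "\<exists>h\<in>hom G \<G>. \<forall>x\<in>X. h (\<iota> x) = perm_generator X r x"
    using perm_generator_relation
    by (intro structure_group_universal[OF \<G>.is_group] perm_generator_in_permutation_group)
      (simp_all only: permutation_group_simps(2))
  then have "\<exists>h. h \<in> hom G \<G> \<and> (\<forall>x\<in>X. h (\<iota> x) = perm_generator X r x)" by blast
  from someI_ex[OF this] show "\<pi> \<in> hom G \<G>" "x \<in> X \<Longrightarrow> \<pi> (\<iota> x) = perm_generator X r x"
    unfolding permutation_proj_def by auto
qed

sublocale \<pi>: group_hom G \<G> \<pi>
  by unfold_locales (rule permutation_proj)

text \<open>
  Both groups are generated by corresponding elements. Together with \<open>\<pi>\<close> being a homomorphism, this
  allows computations in the permutation group to be done with representatives.
\<close>

lemma permutation_proj_image: "\<pi> ` carrier G = carrier \<G>"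
proof -
  have "\<pi> ` carrier G = generate \<G> (\<pi> ` \<iota> ` X)"
    using \<pi>.generate_img[of "\<iota> ` X"] by (simp add: generate_iota image_subset_iff)
  also have "\<pi> ` \<iota> ` X = perm_generator X r ` X"
    by (simp add: image_image permutation_proj(2) cong: image_cong)
  finally show ?thesis by (simp add: generate_perm_generator)
qed

text \<open>
  The two actions of the structure group on \<open>X\<close>, extending \<open>x \<mapsto> \<sigma> x\<close> and \<open>x \<mapsto> inv (\<tau> x)\<close> to words.
\<close>

definition left_action :: "'a word set \<Rightarrow> 'a \<Rightarrow> 'a" where
  "left_action a = fst (\<pi> a)"

definition right_action :: "'a word set \<Rightarrow> 'a \<Rightarrow> 'a" where
  "right_action a = snd (\<pi> a)"

lemma permutation_group_carrier: "carrier \<G> \<subseteq> Bij X \<times> Bij X"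
  using group.generate_incl[OF group_DirProd_BijGroup perm_generators_closed]
  by (simp add: permutation_group_simps DirProd_def)

lemma action_Bij:
  assumes "a \<in> carrier G"
  shows "left_action a \<in> Bij X" "right_action a \<in> Bij X"
  using subsetD[OF permutation_group_carrier \<pi>.hom_closed[OF assms]]
  by (auto simp: left_action_def right_action_def)

lemma action_closed [simp]:
  assumes "a \<in> carrier G" "x \<in> X"
  shows "left_action a x \<in> X" "right_action a x \<in> X"
  using action_Bij[OF assms(1)] assms(2) by (auto intro: Bij_closed)

lemma action_mult [simp]:
  assumes "a \<in> carrier G" "b \<in> carrier G" "x \<in> X"
  shows "left_action (a \<otimes>\<^bsub>G\<^esub> b) x = left_action a (left_action b x)"
    "right_action (a \<otimes>\<^bsub>G\<^esub> b) x = right_action a (right_action b x)"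
  using action_Bij[OF assms(1)] action_Bij[OF assms(2)] assms
  by (auto simp: left_action_def right_action_def permutation_group_simps(2) DirProd_def
      compose_def split: prod.splits)

lemma action_one [simp]:
  assumes "x \<in> X"
  shows "left_action \<one>\<^bsub>G\<^esub> x = x" "right_action \<one>\<^bsub>G\<^esub> x = x"
  using assms by (simp_all add: left_action_def right_action_def permutation_group_simps(3) DirProd_def)

lemma action_inv [simp]:
  assumes "a \<in> carrier G" "x \<in> X"
  shows "left_action (inv\<^bsub>G\<^esub> a) (left_action a x) = x"
    "left_action a (left_action (inv\<^bsub>G\<^esub> a) x) = x"
    "right_action a (right_action (inv\<^bsub>G\<^esub> a) x) = x"
  using action_mult[of "inv\<^bsub>G\<^esub> a" a x] action_mult[of a "inv\<^bsub>G\<^esub> a" x] assms by auto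

lemma action_iota [simp]:
  assumes "x \<in> X" "y \<in> X"
  shows "left_action (\<iota> x) y = \<sigma> x y" "right_action (\<iota> x) y = inv_into X (\<tau> x) y"
  using assms by (simp_all add: left_action_def right_action_def permutation_proj perm_generator_def)

lemma diag_right_action:
  assumes "a \<in> carrier G" "x \<in> X"
  shows "diag (right_action a x) = left_action a (diag x)"
  using assms
proof (induction arbitrary: x rule: structure_group_induct)
  case (incl y)
  then show ?case using sigma_diag_tau[of "inv_into X (\<tau> y) x" y] by simp
next
  case (inv y)
  let ?x' = "right_action (inv\<^bsub>G\<^esub> \<iota> y) x"
  have "diag x = left_action (\<iota> y) (diag ?x')"
    using inv(2)[of ?x'] inv by (simp del: action_iota)
  then show ?case using inv by (simp del: action_iota)
qed simp_all

text \<open>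
  The second component of \<open>\<pi> a\<close> is conjugate to the first by \<open>diag\<close>, with a conjugating map that does
  not depend on \<open>a\<close>; so the first component determines \<open>\<pi> a\<close>.
\<close>

lemma permutation_proj_eqI:
  assumes "a \<in> carrier G" "b \<in> carrier G" "\<And>x. x \<in> X \<Longrightarrow> left_action a x = left_action b x"
  shows "\<pi> a = \<pi> b"
proof (rule prod_eqI)
  have ext: "left_action c \<in> extensional X" "right_action c \<in> extensional X" if "c \<in> carrier G" for c
    using action_Bij[OF that] by (auto dest: Bij_imp_extensional)
  show "fst (\<pi> a) = fst (\<pi> b)"
    using ext assms unfolding left_action_def[symmetric] by (metis extensionalityI)
  have "right_action a x = right_action b x" if "x \<in> X" for x
    using that assms diag_right_action diag_inj by (metis action_closed(2) diag_closed)
  then show "snd (\<pi> a) = snd (\<pi> b)"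
    using ext assms unfolding right_action_def[symmetric] by (metis extensionalityI)
qed

section \<open>The additive group\<close>

text \<open>
  The prospective translation by \<open>\<iota> x\<close> in the additive group. In a skew brace with abelian additive
  group, \<open>\<iota> x \<cdot> a = a \<cdot> \<iota> x\<close> is the product of \<open>a\<close> with \<open>\<gamma>(inv a)(\<iota> x)\<close> in the multiplicative group,
  and \<open>\<gamma>\<close> has to act on generators in the same way as \<open>left_action\<close>.
\<close>

definition add_generator :: "'a \<Rightarrow> 'a word set \<Rightarrow> 'a word set" where
  "add_generator x = (\<lambda>a\<in>carrier G. a \<otimes>\<^bsub>G\<^esub> \<iota> (left_action (inv\<^bsub>G\<^esub> a) x))"

lemma add_generator_Bij:
  assumes x: "x \<in> X"
  shows "add_generator x \<in> Bij (carrier G)"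
proof (rule BijI[where g = "\<lambda>a. a \<otimes>\<^bsub>G\<^esub> inv\<^bsub>G\<^esub> \<iota> (inv_into X diag (left_action (inv\<^bsub>G\<^esub> a) x))"])
  \<comment> \<open>The inverse map removes from \<open>a\<close> the letter \<open>z\<close> for which \<open>a\<close> moves \<open>diag z\<close> to \<open>x\<close>; so \<open>diag\<close> must be bijective.\<close>
  have diag_inv: "inv_into X diag (diag y) = y" if "y \<in> X" for y
    using that diag_inj by (intro inv_into_f_f inj_onI) auto
  have diag_surj: "\<exists>z\<in>X. y = diag z" if y: "y \<in> X" for y
  proof (rule bexI)
    let ?z = "inv_into X (\<tau> y) y"
    have z: "?z \<in> X" "\<tau> y ?z = y" using y by auto
    have "\<sigma> ?z y = ?z"
      using sigma_tau_involutive(2)[of ?z y] z y by (metis sigma_closed tau_cancel)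
    then show "y = diag ?z" using z y by (metis sigma_inv_sigma diag_def)
    show "?z \<in> X" by fact
  qed
  fix a assume a: "a \<in> carrier G"
  show "add_generator x a \<in> carrier G"
    using a x by (simp add: add_generator_def)
  obtain z where z: "z \<in> X" "left_action (inv\<^bsub>G\<^esub> a) x = diag z"
    using diag_surj a x by (meson G.inv_closed action_closed(1))
  then show "a \<otimes>\<^bsub>G\<^esub> inv\<^bsub>G\<^esub> \<iota> (inv_into X diag (left_action (inv\<^bsub>G\<^esub> a) x)) \<in> carrier G"
    using a by (simp add: diag_inv)
  have "left_action (inv\<^bsub>G\<^esub> (a \<otimes>\<^bsub>G\<^esub> inv\<^bsub>G\<^esub> \<iota> z)) x = z"
    using a z x by (simp add: G.inv_mult_group)
  then show "add_generator x (a \<otimes>\<^bsub>G\<^esub> inv\<^bsub>G\<^esub> \<iota> (inv_into X diag (left_action (inv\<^bsub>G\<^esub> a) x))) = a"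
    using a z by (simp add: diag_inv add_generator_def G.m_assoc)
  let ?y = "left_action (inv\<^bsub>G\<^esub> a) x"
  have y: "?y \<in> X" using a x by simp
  have "left_action (inv\<^bsub>G\<^esub> (a \<otimes>\<^bsub>G\<^esub> \<iota> ?y)) x = left_action (inv\<^bsub>G\<^esub> \<iota> ?y) (left_action (\<iota> ?y) (diag ?y))"
    using a x y by (simp add: G.inv_mult_group del: action_inv)
  also have "\<dots> = diag ?y"
    using y by (intro action_inv) auto
  finally show "add_generator x a \<otimes>\<^bsub>G\<^esub>
      inv\<^bsub>G\<^esub> \<iota> (inv_into X diag (left_action (inv\<^bsub>G\<^esub> add_generator x a) x)) = a"
    using a x y by (simp add: diag_inv add_generator_def G.m_assoc)
qed (simp add: add_generator_def)

text \<open>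
  In either order, the two translations append two letters to \<open>a\<close>; the second letter is \<open>u\<close> or \<open>v\<close>,
  corrected by the action of the first. The two resulting words of length two are the two sides of one defining
  relation of the structure group.
\<close>

lemma add_generator_commute:
  assumes x: "x \<in> X" and y: "y \<in> X" and a: "a \<in> carrier G"
  shows "add_generator x (add_generator y a) = add_generator y (add_generator x a)"
proof -
  define u where "u = left_action (inv\<^bsub>G\<^esub> a) x"
  define v where "v = left_action (inv\<^bsub>G\<^esub> a) y"
  have uv: "u \<in> X" "v \<in> X" using assms by (auto simp: u_def v_def)
  have step: "add_generator x (add_generator y a)
      = a \<otimes>\<^bsub>G\<^esub> (\<iota> (left_action (inv\<^bsub>G\<^esub> a) y) \<otimes>\<^bsub>G\<^esub>
          \<iota> (left_action (inv\<^bsub>G\<^esub> \<iota> (left_action (inv\<^bsub>G\<^esub> a) y)) (left_action (inv\<^bsub>G\<^esub> a) x)))"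
    if "x \<in> X" "y \<in> X" for x y
    using that a by (simp add: add_generator_def G.inv_mult_group G.m_assoc)
  define w where "w = left_action (inv\<^bsub>G\<^esub> \<iota> v) u"
  have w: "w \<in> X" "\<sigma> v w = u"
    using uv action_iota(1)[of v w] by (auto simp: w_def simp del: action_iota)
  have "left_action (inv\<^bsub>G\<^esub> \<iota> u) v = left_action (inv\<^bsub>G\<^esub> \<iota> u) (left_action (\<iota> u) (\<tau> w v))"
    using sigma_tau_involutive(1)[of v w] w uv by simp
  also have "\<dots> = \<tau> w v"
    using uv w by (intro action_inv) auto
  finally have "\<iota> v \<otimes>\<^bsub>G\<^esub> \<iota> w = \<iota> u \<otimes>\<^bsub>G\<^esub> \<iota> (left_action (inv\<^bsub>G\<^esub> \<iota> u) v)"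
    using iota_relation[of v w] w uv by simp
  then show ?thesis
    using step[OF x y] step[OF y x] by (simp add: w_def u_def v_def)
qed

lemma mult_add_generator:
  assumes "x \<in> X" "a \<in> carrier G" "b \<in> carrier G"
  shows "a \<otimes>\<^bsub>G\<^esub> add_generator x b = add_generator (left_action a x) (a \<otimes>\<^bsub>G\<^esub> b)"
  using assms by (simp add: add_generator_def G.inv_mult_group G.m_assoc)

lemma add_generator_one: "x \<in> X \<Longrightarrow> add_generator x \<one>\<^bsub>G\<^esub> = \<iota> x"
  by (simp add: add_generator_def)

text \<open>
  Multiplying by a generator or its inverse from the right is the same as applying some
  \<open>add_generator\<close> or its inverse, the index of which depends on the point. Hence an orbit is
  closed under right multiplication by all of the structure group.
\<close>

lemma add_generator_transitive:
  "(\<lambda>f. f \<one>\<^bsub>G\<^esub>) ` generate (BijGroup (carrier G)) (add_generator ` X) = carrier G"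
    (is "?O = _")
proof
  let ?B = "BijGroup (carrier G)"
  let ?P = "generate ?B (add_generator ` X)"
  interpret B: group ?B by (rule group_BijGroup)
  have P: "?P \<subseteq> Bij (carrier G)"
    using B.generate_incl[of "add_generator ` X"] add_generator_Bij by auto
  then show "?O \<subseteq> carrier G"
    by (auto intro: Bij_closed)
  have orbit: "f a \<in> ?O" if f: "f \<in> ?P" and "a \<in> ?O" for f a
  proof -
    obtain h where h: "h \<in> ?P" "a = h \<one>\<^bsub>G\<^esub>" using \<open>a \<in> ?O\<close> by blast
    then have "f a = (f \<otimes>\<^bsub>?B\<^esub> h) \<one>\<^bsub>G\<^esub>"
      using P f by (auto simp: compose_def subset_iff)
    then show ?thesis
      by (rule image_eqI[where f = "\<lambda>f. f \<one>\<^bsub>G\<^esub>", OF _ generate.eng[OF f h(1)]])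
  qed
  have "b \<otimes>\<^bsub>G\<^esub> a \<in> ?O" if "a \<in> carrier G" "b \<in> ?O" for a b
    using that
  proof (induction arbitrary: b rule: structure_group_induct)
    case one
    then have "b \<in> carrier G" using \<open>?O \<subseteq> carrier G\<close> by blast
    then have "b \<otimes>\<^bsub>G\<^esub> \<one>\<^bsub>G\<^esub> = b" by (rule G.r_one)
    with one show ?case by (simp only:)
  next
    case (incl x)
    then have b: "b \<in> carrier G" using \<open>?O \<subseteq> carrier G\<close> by blast
    have "b \<otimes>\<^bsub>G\<^esub> \<iota> x = add_generator (left_action b x) b"
      using incl b by (simp add: add_generator_def)
    also have "\<dots> \<in> ?O"
      by (rule orbit[OF generate.incl[OF imageI]]) (use incl b in \<open>auto simp only: action_closed\<close>)
    finally show ?case .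
  next
    case (inv x)
    then have b: "b \<in> carrier G" using \<open>?O \<subseteq> carrier G\<close> by blast
    \<comment> \<open>The index \<open>?y\<close> is chosen such that the translation appends exactly the letter \<open>x\<close> to \<open>?c\<close>.\<close>
    let ?c = "b \<otimes>\<^bsub>G\<^esub> inv\<^bsub>G\<^esub> \<iota> x"
    let ?y = "left_action ?c x"
    have y: "?y \<in> X" and c: "?c \<in> carrier G" using inv b by auto
    have "add_generator ?y ?c = ?c \<otimes>\<^bsub>G\<^esub> \<iota> x"
      using y c inv action_inv(1)[OF c] by (simp add: add_generator_def del: action_mult)
    also have "\<dots> = b"
      using b inv by (simp add: G.m_assoc)
    finally have "?c = (inv\<^bsub>?B\<^esub> add_generator ?y) b"
      using BijGroup_inv_apply(1)[OF add_generator_Bij[OF y] c] by simp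
    also have "\<dots> \<in> ?O"
      by (rule orbit[OF generate.inv[OF imageI]]) (fact y, fact inv.prems)
    finally show ?case .
  next
    case (eng a a')
    then have "b \<in> carrier G" using \<open>?O \<subseteq> carrier G\<close> by blast
    then have "b \<otimes>\<^bsub>G\<^esub> (a \<otimes>\<^bsub>G\<^esub> a') = b \<otimes>\<^bsub>G\<^esub> a \<otimes>\<^bsub>G\<^esub> a'"
      using eng.hyps by (simp add: G.m_assoc)
    then show ?case using eng.IH eng.prems by (simp only:)
  qed
  moreover have "\<one>\<^bsub>G\<^esub> \<in> ?O"
    by (rule image_eqI[OF _ generate.one]) simp
  ultimately show "carrier G \<subseteq> ?O"
    by (metis G.l_one subsetI)
qed

text \<open>
  The translations \<open>add_generator x\<close> generate an abelian transitive group that the left translations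
  normalize; the induced skew brace satisfies the specification of the structure skew brace. From
  here on only the specification is used, so that nothing depends on which group the choice operator
  picks.
\<close>

lemma structure_add_group:
  "skew_brace (structure_add_group X r) G"
  "generate (structure_add_group X r) (\<iota> ` X) = carrier (structure_add_group X r)"
  "solution_hom X r (carrier (structure_add_group X r))
    (brace_solution (structure_add_group X r) G) \<iota>"
proof -
  have "\<exists>A. skew_brace A G \<and> generate A (\<iota> ` X) = carrier A \<and>
      solution_hom X r (carrier A) (brace_solution A G) \<iota>"
  proof (rule skew_brace_of_abelian_permutations[OF G.is_group, of "add_generator ` X"])
    show "add_generator ` X \<subseteq> Bij (carrier G)"
      using add_generator_Bij by auto
    show "(\<lambda>f. f \<one>\<^bsub>G\<^esub>) ` generate (BijGroup (carrier G)) (add_generator ` X) = carrier G"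
      by (rule add_generator_transitive)
    show "f (g a) = g (f a)"
      if "f \<in> add_generator ` X" "g \<in> add_generator ` X" "a \<in> carrier G" for f g a
      using that by (auto simp: add_generator_commute)
    show "\<exists>f'\<in>add_generator ` X. \<forall>g\<in>carrier G. a \<otimes>\<^bsub>G\<^esub> f g = f' (a \<otimes>\<^bsub>G\<^esub> g)"
      if "f \<in> add_generator ` X" "a \<in> carrier G" for f a
      using that by (force simp: mult_add_generator)
  next
    fix A assume A: "skew_brace A G" "comm_group A" "carrier A = carrier G"
      and gen: "generate A ((\<lambda>f. f \<one>\<^bsub>G\<^esub>) ` add_generator ` X) = carrier A"
      and act: "\<And>f a. f \<in> add_generator ` X \<Longrightarrow> a \<in> carrier G \<Longrightarrow> f \<one>\<^bsub>G\<^esub> \<otimes>\<^bsub>A\<^esub> a = f a"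
    interpret A: comm_group A by fact
    have "(\<lambda>f. f \<one>\<^bsub>G\<^esub>) ` add_generator ` X = \<iota> ` X"
      by (simp add: image_image add_generator_one cong: image_cong)
    with gen have "generate A (\<iota> ` X) = carrier A" by simp
    moreover have "solution_hom X r (carrier A) (brace_solution A G) \<iota>"
    proof -
      have gamma: "gamma A G (\<iota> x) (\<iota> y) = \<iota> (\<sigma> x y)" if xy: "x \<in> X" "y \<in> X" for x y
      proof -
        have c: "\<iota> x \<in> carrier A" "\<iota> (\<sigma> x y) \<in> carrier A"
          using xy A(3) by auto
        have "\<iota> x \<otimes>\<^bsub>G\<^esub> \<iota> y = add_generator (\<sigma> x y) (\<iota> x)"
          using mult_add_generator[of y "\<iota> x" "\<one>\<^bsub>G\<^esub>"] xy by (simp add: add_generator_one)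
        also have "\<dots> = \<iota> (\<sigma> x y) \<otimes>\<^bsub>A\<^esub> \<iota> x"
          using act[of "add_generator (\<sigma> x y)" "\<iota> x"] xy by (simp add: add_generator_one)
        also have "\<dots> = \<iota> x \<otimes>\<^bsub>A\<^esub> \<iota> (\<sigma> x y)"
          using c by (rule A.m_comm[rotated])
        finally show ?thesis
          using c by (simp add: gamma_def flip: A.m_assoc)
      qed
      have "map_prod \<iota> \<iota> (r (x, y)) = brace_solution A G (\<iota> x, \<iota> y)" if xy: "x \<in> X" "y \<in> X" for x y
      proof -
        have "inv\<^bsub>G\<^esub> \<iota> (\<sigma> x y) \<otimes>\<^bsub>G\<^esub> \<iota> x \<otimes>\<^bsub>G\<^esub> \<iota> y = \<iota> (\<tau> y x)"
          using xy iota_relation[OF xy] by (simp add: G.m_assoc flip: G.m_assoc[of "inv\<^bsub>G\<^esub> _" "\<iota> (\<sigma> x y)"])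
        then show ?thesis using xy by (simp add: brace_solution_def r_eq gamma)
      qed
      then show ?thesis by (auto simp: solution_hom_def A(3))
    qed
    ultimately show ?thesis using A(1) by blast
  qed
  from someI_ex[OF this]
  show "skew_brace (structure_add_group X r) G"
    "generate (structure_add_group X r) (\<iota> ` X) = carrier (structure_add_group X r)"
    "solution_hom X r (carrier (structure_add_group X r))
      (brace_solution (structure_add_group X r) G) \<iota>"
    unfolding structure_add_group_def by auto
qed

end

section \<open>The gamma function\<close>

context skew_brace
begin

lemma one_eq: "\<one>\<^bsub>M\<^esub> = \<one>\<^bsub>A\<^esub>"
proof -
  have c: "\<one>\<^bsub>A\<^esub> \<in> carrier M" by (simp add: carrier_eq)
  show ?thesis
    using skew_distrib[of "\<one>\<^bsub>A\<^esub>" "\<one>\<^bsub>A\<^esub>" "\<one>\<^bsub>A\<^esub>"] multiplicative.m_closed[OF c c]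
    by (simp add: carrier_eq)
qed

lemma mult_closed [simp]: "a \<in> carrier A \<Longrightarrow> b \<in> carrier A \<Longrightarrow> a \<otimes>\<^bsub>M\<^esub> b \<in> carrier A"
  and mult_inv_closed [simp]: "a \<in> carrier A \<Longrightarrow> inv\<^bsub>M\<^esub> a \<in> carrier A"
  using multiplicative.m_closed multiplicative.inv_closed by (simp_all add: carrier_eq)

lemma gamma_closed [simp]: "a \<in> carrier A \<Longrightarrow> b \<in> carrier A \<Longrightarrow> gamma A M a b \<in> carrier A"
  by (simp add: gamma_def)

lemma mult_gamma: "a \<in> carrier A \<Longrightarrow> b \<in> carrier A \<Longrightarrow> a \<otimes>\<^bsub>M\<^esub> b = a \<otimes>\<^bsub>A\<^esub> gamma A M a b"
  by (simp add: gamma_def flip: additive.m_assoc)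

lemma gamma_hom:
  assumes "a \<in> carrier A"
  shows "gamma A M a \<in> hom A A"
  by (rule homI) (use assms in \<open>auto simp: gamma_def skew_distrib additive.m_assoc\<close>)

lemma gamma_mult:
  assumes "a \<in> carrier A" "b \<in> carrier A" "c \<in> carrier A"
  shows "gamma A M (a \<otimes>\<^bsub>M\<^esub> b) c = gamma A M a (gamma A M b c)"
proof -
  have "(a \<otimes>\<^bsub>M\<^esub> b) \<otimes>\<^bsub>M\<^esub> c = a \<otimes>\<^bsub>M\<^esub> (b \<otimes>\<^bsub>A\<^esub> gamma A M b c)"
    using assms mult_gamma[of b c] multiplicative.m_assoc by (simp add: carrier_eq)
  also have "\<dots> = (a \<otimes>\<^bsub>M\<^esub> b) \<otimes>\<^bsub>A\<^esub> gamma A M a (gamma A M b c)"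
    using assms by (simp add: skew_distrib additive.m_assoc gamma_def[of A M a])
  finally show ?thesis
    using assms by (simp add: gamma_def[of A M "a \<otimes>\<^bsub>M\<^esub> b"] flip: additive.m_assoc)
qed

lemma gamma_one [simp]: "b \<in> carrier A \<Longrightarrow> gamma A M \<one>\<^bsub>M\<^esub> b = b"
  using multiplicative.l_one[of b] carrier_eq by (simp add: gamma_def one_eq)

lemma gamma_inv [simp]:
  assumes "a \<in> carrier A" "b \<in> carrier A"
  shows "gamma A M (inv\<^bsub>M\<^esub> a) (gamma A M a b) = b" "gamma A M a (gamma A M (inv\<^bsub>M\<^esub> a) b) = b"
  using assms gamma_mult[of "inv\<^bsub>M\<^esub> a" a b] gamma_mult[of a "inv\<^bsub>M\<^esub> a" b]
  by (simp_all add: carrier_eq)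

lemma add_gamma:
  assumes "a \<in> carrier A" "b \<in> carrier A"
  shows "a \<otimes>\<^bsub>A\<^esub> b = a \<otimes>\<^bsub>M\<^esub> gamma A M (inv\<^bsub>M\<^esub> a) b"
  using assms by (simp add: mult_gamma)

lemma gamma_add:
  assumes "a \<in> carrier A" "b \<in> carrier A" "c \<in> carrier A"
  shows "gamma A M (a \<otimes>\<^bsub>A\<^esub> b) c = gamma A M a (gamma A M (gamma A M (inv\<^bsub>M\<^esub> a) b) c)"
  using assms by (simp add: add_gamma gamma_mult)

text \<open>
  In the law \<open>a \<cdot> (b \<circ> c') = (a \<cdot> b) \<circ> inv a \<circ> (a \<cdot> c')\<close>, substitute \<open>c' = \<gamma>(a)(c)\<close>. Then
  \<open>a \<cdot> c' = a \<circ> c\<close>, the right side collapses to \<open>(a \<cdot> b) \<circ> c\<close>, and after cancelling \<open>a \<cdot> b\<close> what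
  remains is that \<open>\<gamma>\<close> is an antihomomorphism on the additive group.
\<close>

lemma bi_skew_brace_iff:
  "bi_skew_brace A M \<longleftrightarrow> (\<forall>a\<in>carrier A. \<forall>b\<in>carrier A. \<forall>c\<in>carrier A.
     gamma A M (a \<otimes>\<^bsub>A\<^esub> b) c = gamma A M b (gamma A M a c))"
proof -
  have distrib_iff: "a \<otimes>\<^bsub>A\<^esub> (b \<otimes>\<^bsub>M\<^esub> gamma A M a c)
        = (a \<otimes>\<^bsub>A\<^esub> b) \<otimes>\<^bsub>M\<^esub> inv\<^bsub>M\<^esub> a \<otimes>\<^bsub>M\<^esub> (a \<otimes>\<^bsub>A\<^esub> gamma A M a c)
      \<longleftrightarrow> gamma A M (a \<otimes>\<^bsub>A\<^esub> b) c = gamma A M b (gamma A M a c)"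
    if c: "a \<in> carrier A" "b \<in> carrier A" "c \<in> carrier A" for a b c
  proof -
    have "(a \<otimes>\<^bsub>A\<^esub> b) \<otimes>\<^bsub>M\<^esub> inv\<^bsub>M\<^esub> a \<otimes>\<^bsub>M\<^esub> (a \<otimes>\<^bsub>A\<^esub> gamma A M a c)
        = (a \<otimes>\<^bsub>A\<^esub> b) \<otimes>\<^bsub>M\<^esub> inv\<^bsub>M\<^esub> a \<otimes>\<^bsub>M\<^esub> (a \<otimes>\<^bsub>M\<^esub> c)"
      using c by (simp add: mult_gamma)
    also have "\<dots> = (a \<otimes>\<^bsub>A\<^esub> b) \<otimes>\<^bsub>M\<^esub> c"
      using c additive.m_closed[OF c(1,2)]
      by (simp add: carrier_eq[symmetric] multiplicative.m_assoc
          flip: multiplicative.m_assoc[of "inv\<^bsub>M\<^esub> a" a c])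
    also have "\<dots> = a \<otimes>\<^bsub>A\<^esub> (b \<otimes>\<^bsub>A\<^esub> gamma A M (a \<otimes>\<^bsub>A\<^esub> b) c)"
      using c by (simp add: mult_gamma additive.m_assoc)
    finally show ?thesis
      using c by (auto simp: mult_gamma)
  qed
  have "bi_skew_brace A M \<longleftrightarrow> (\<forall>a\<in>carrier A. \<forall>b\<in>carrier A. \<forall>c\<in>carrier A.
      a \<otimes>\<^bsub>A\<^esub> (b \<otimes>\<^bsub>M\<^esub> c) = (a \<otimes>\<^bsub>A\<^esub> b) \<otimes>\<^bsub>M\<^esub> inv\<^bsub>M\<^esub> a \<otimes>\<^bsub>M\<^esub> (a \<otimes>\<^bsub>A\<^esub> c))"
    using skew_brace_axioms additive.is_group multiplicative.is_group
    by (simp add: bi_skew_brace_def skew_brace_def[of M A] skew_brace_axioms_def carrier_eq) blast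
  also have "\<dots> \<longleftrightarrow> (\<forall>a\<in>carrier A. \<forall>b\<in>carrier A. \<forall>c\<in>carrier A.
      a \<otimes>\<^bsub>A\<^esub> (b \<otimes>\<^bsub>M\<^esub> gamma A M a c)
        = (a \<otimes>\<^bsub>A\<^esub> b) \<otimes>\<^bsub>M\<^esub> inv\<^bsub>M\<^esub> a \<otimes>\<^bsub>M\<^esub> (a \<otimes>\<^bsub>A\<^esub> gamma A M a c))"
    by (metis gamma_closed gamma_inv(2) mult_inv_closed)
  finally show ?thesis
    using distrib_iff by simp
qed

end

text \<open>
  On the additive group, \<open>\<gamma>\<close> is twisted multiplicative: \<open>\<gamma>(a \<cdot> b) = \<gamma>(a) \<gamma>(\<gamma>(inv a)(b))\<close>. When addition is
  commutative, being an antihomomorphism is the same as the twist being invisible to \<open>\<gamma>\<close>.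
\<close>

lemma bi_skew_brace_iff_gamma_invariant:
  assumes "brace A M"
  shows "bi_skew_brace A M \<longleftrightarrow> (\<forall>a\<in>carrier A. \<forall>b\<in>carrier A. \<forall>c\<in>carrier A.
    gamma A M (gamma A M a b) c = gamma A M b c)"
proof -
  interpret skew_brace A M using assms by (simp add: brace_def)
  interpret comm_group A using assms by (simp add: brace_def)
  show ?thesis
    unfolding bi_skew_brace_iff
  proof (intro iffI ballI)
    fix a b c
    assume bi: "\<forall>a\<in>carrier A. \<forall>b\<in>carrier A. \<forall>c\<in>carrier A.
        gamma A M (a \<otimes>\<^bsub>A\<^esub> b) c = gamma A M b (gamma A M a c)"
      and c: "a \<in> carrier A" "b \<in> carrier A" "c \<in> carrier A"
    let ?b' = "gamma A M a b"
    have "gamma A M a (gamma A M ?b' c) = gamma A M (?b' \<otimes>\<^bsub>A\<^esub> a) c"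
      using bi c by simp
    also have "?b' \<otimes>\<^bsub>A\<^esub> a = a \<otimes>\<^bsub>M\<^esub> b"
      using c by (simp add: mult_gamma m_comm)
    also have "gamma A M \<dots> c = gamma A M a (gamma A M b c)"
      using c by (simp add: gamma_mult)
    finally show "gamma A M ?b' c = gamma A M b c"
      using c by (metis gamma_closed gamma_inv(1))
  next
    fix a b c
    assume inv: "\<forall>a\<in>carrier A. \<forall>b\<in>carrier A. \<forall>c\<in>carrier A.
        gamma A M (gamma A M a b) c = gamma A M b c"
      and c: "a \<in> carrier A" "b \<in> carrier A" "c \<in> carrier A"
    have "gamma A M (a \<otimes>\<^bsub>A\<^esub> b) c = gamma A M (b \<otimes>\<^bsub>A\<^esub> a) c"
      using c by (simp add: m_comm)
    also have "\<dots> = gamma A M b (gamma A M a c)"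
      using inv c by (simp add: gamma_add)
    finally show "gamma A M (a \<otimes>\<^bsub>A\<^esub> b) c = gamma A M b (gamma A M a c)" .
  qed
qed

lemma trivial_solution_flip:
  assumes "X \<noteq> {}" "\<And>x y. x \<in> X \<Longrightarrow> y \<in> X \<Longrightarrow> r (x, y) = (y, x)"
  shows "trivial_solution X r"
proof -
  have "solution X r"
  proof
    show "bij_betw r (X \<times> X) (X \<times> X)"
      by (rule bij_betw_byWitness[where f' = r]) (auto simp: assms(2))
    show "bij_betw (sigma r x) X X" "bij_betw (tau r x) X X" if "x \<in> X" for x
      using that
      by (auto simp: sigma_def tau_def assms(2) intro!: bij_betw_byWitness[where f' = id])
  qed (auto simp: assms act12_def act23_def)
  then show ?thesis
    using assms by (simp add: trivial_solution_def)
qed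

section \<open>The structure brace and the permutation brace\<close>

context involutive
begin

abbreviation A :: "'a word set monoid" where
  "A \<equiv> structure_add_group X r"

abbreviation Q :: "(('a \<Rightarrow> 'a) \<times> ('a \<Rightarrow> 'a)) monoid" where
  "Q \<equiv> permutation_add_group X r"

sublocale B: skew_brace A G
  by (rule structure_add_group)

lemmas carrier_A = B.carrier_eq[symmetric]

lemma generate_iota_add: "generate A (\<iota> ` X) = carrier G"
  using structure_add_group(2) by (simp add: carrier_A)

lemma gamma_iota:
  assumes "x \<in> X" "y \<in> X"
  shows "gamma A G (\<iota> x) (\<iota> y) = \<iota> (\<sigma> x y)"
  using structure_add_group(3) assms
  by (auto simp: solution_hom_def brace_solution_def r_eq)

text \<open>
  With \<open>z = \<sigma> x y\<close>, the two sums are the two sides of the relation \<open>x \<circ> y = \<sigma> x y \<circ> \<tau> y x\<close>: the second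
  one because \<open>\<gamma>\<close> of \<open>\<iota> z\<close> sends \<open>\<iota> (\<tau> y x)\<close> back to \<open>\<iota> x\<close>, by involutivity.
\<close>

lemma iota_add_commute:
  assumes "x \<in> X" "z \<in> X"
  shows "\<iota> x \<otimes>\<^bsub>A\<^esub> \<iota> z = \<iota> z \<otimes>\<^bsub>A\<^esub> \<iota> x"
proof -
  define y where "y = inv_into X (\<sigma> x) z"
  have y: "y \<in> X" "z = \<sigma> x y" using assms by (auto simp: y_def)
  have "\<iota> x \<otimes>\<^bsub>A\<^esub> \<iota> z = \<iota> x \<otimes>\<^bsub>G\<^esub> \<iota> y"
    using y assms by (simp add: B.mult_gamma carrier_A gamma_iota)
  also have "\<dots> = \<iota> z \<otimes>\<^bsub>G\<^esub> \<iota> (\<tau> y x)"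
    using y(2) iota_relation[OF assms(1) y(1)] by simp
  also have "\<dots> = \<iota> z \<otimes>\<^bsub>A\<^esub> \<iota> x"
    using y assms by (simp add: B.mult_gamma carrier_A gamma_iota sigma_tau_involutive)
  finally show ?thesis .
qed

sublocale A: comm_group A
proof (rule B.additive.group_comm_groupI)
  have gen: "generate A (\<iota> ` X) = carrier A" "\<iota> ` X \<subseteq> carrier A"
    by (auto simp: generate_iota_add carrier_A)
  fix a b assume "a \<in> carrier A" "b \<in> carrier A"
  then show "a \<otimes>\<^bsub>A\<^esub> b = b \<otimes>\<^bsub>A\<^esub> a"
    unfolding gen(1)[symmetric]
    by (rule B.additive.generate_commute[OF gen(2), rotated]) (use iota_add_commute in blast)
qed

lemma brace_structure: "brace A G"
  using structure_add_group(1) A.comm_group_axioms by (simp add: brace_def)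

lemma hom_eq_on_iota:
  assumes "group H" "f \<in> hom A H" "h \<in> hom A H" "\<And>x. x \<in> X \<Longrightarrow> f (\<iota> x) = h (\<iota> x)"
    and "a \<in> carrier G"
  shows "f a = h a"
  by (rule hom_eq_on_generate[OF B.additive.is_group assms(1-3), of "\<iota> ` X"])
    (use assms(4,5) in \<open>auto simp: carrier_A generate_iota_add\<close>)

text \<open>
  So \<open>\<gamma>(a)\<close>, an automorphism of a group generated by \<open>\<iota> ` X\<close>, is determined by \<open>\<pi> a\<close>.
\<close>

lemma gamma_action:
  assumes "a \<in> carrier G" "y \<in> X"
  shows "gamma A G a (\<iota> y) = \<iota> (left_action a y)"
  using assms
proof (induction arbitrary: y rule: structure_group_induct)
  case one
  then show ?case using B.gamma_one by (simp add: carrier_A)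
next
  case (incl x)
  then show ?case by (simp add: gamma_iota)
next
  case (inv x)
  let ?y' = "left_action (inv\<^bsub>G\<^esub> \<iota> x) y"
  have y': "?y' \<in> X" using inv by simp
  have "gamma A G (inv\<^bsub>G\<^esub> \<iota> x) (\<iota> y) = gamma A G (inv\<^bsub>G\<^esub> \<iota> x) (gamma A G (\<iota> x) (\<iota> ?y'))"
    using inv(2)[OF y'] inv(1,3) by (simp del: action_iota)
  also have "\<dots> = \<iota> ?y'"
    using inv y' by (intro B.gamma_inv) (auto simp: carrier_A)
  finally show ?case .
next
  case (eng a b)
  then show ?case by (simp add: B.gamma_mult carrier_A)
qed

text \<open>
  The kernel of \<open>\<pi>\<close> is the kernel of \<open>\<gamma>\<close>. Injectivity of \<open>\<iota>\<close> is what allows \<open>left_action a\<close> to be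
  recovered from \<open>\<gamma>(a)\<close>.
\<close>

lemma permutation_proj_eq_iff:
  assumes "a \<in> carrier G" "b \<in> carrier G"
  shows "\<pi> a = \<pi> b \<longleftrightarrow> (\<forall>c\<in>carrier G. gamma A G a c = gamma A G b c)"
proof (intro iffI ballI)
  fix c assume eq: "\<pi> a = \<pi> b" and c: "c \<in> carrier G"
  have "gamma A G a \<in> hom A A" "gamma A G b \<in> hom A A"
    using assms by (simp_all add: B.gamma_hom carrier_A)
  then show "gamma A G a c = gamma A G b c"
    by (rule hom_eq_on_iota[OF B.additive.is_group])
      (use assms c eq in \<open>simp_all add: gamma_action left_action_def\<close>)
next
  assume eq: "\<forall>c\<in>carrier G. gamma A G a c = gamma A G b c"
  have "left_action a x = left_action b x" if x: "x \<in> X" for x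
  proof -
    have "\<iota> (left_action a x) = \<iota> (left_action b x)"
      using eq x assms by (simp flip: gamma_action)
    then show ?thesis using iota_inj x assms by (simp add: inj_on_eq_iff)
  qed
  then show "\<pi> a = \<pi> b"
    using assms by (intro permutation_proj_eqI)
qed

text \<open>
  The sum \<open>a \<cdot> b\<close> is \<open>a \<circ> \<gamma>(inv a)(b)\<close>, where the second factor depends on \<open>a\<close> only through \<open>\<pi> a\<close>.
\<close>

lemma permutation_proj_add_left:
  assumes "a \<in> carrier G" "a' \<in> carrier G" "b \<in> carrier G" "\<pi> a = \<pi> a'"
  shows "\<pi> (a \<otimes>\<^bsub>A\<^esub> b) = \<pi> (a' \<otimes>\<^bsub>A\<^esub> b)"
proof -
  have "\<pi> (inv\<^bsub>G\<^esub> a) = \<pi> (inv\<^bsub>G\<^esub> a')"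
    using assms by (simp add: \<pi>.hom_inv)
  then have "gamma A G (inv\<^bsub>G\<^esub> a) b = gamma A G (inv\<^bsub>G\<^esub> a') b"
    using assms permutation_proj_eq_iff[of "inv\<^bsub>G\<^esub> a" "inv\<^bsub>G\<^esub> a'"] by simp
  moreover have "gamma A G (inv\<^bsub>G\<^esub> a') b \<in> carrier G"
    using assms B.gamma_closed by (simp add: carrier_A)
  ultimately show ?thesis
    using assms by (simp add: B.add_gamma carrier_A)
qed

text \<open>
  The chosen preimages do not matter: each summand may be exchanged in turn, by commutativity.
\<close>

lemma permutation_proj_add:
  assumes "a \<in> carrier G" "b \<in> carrier G"
  shows "\<pi> (a \<otimes>\<^bsub>A\<^esub> b) = \<pi> a \<otimes>\<^bsub>Q\<^esub> \<pi> b"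
proof -
  define a' where "a' = inv_into (carrier G) \<pi> (\<pi> a)"
  define b' where "b' = inv_into (carrier G) \<pi> (\<pi> b)"
  have a': "a' \<in> carrier G" "\<pi> a' = \<pi> a"
    using assms by (auto simp: a'_def f_inv_into_f inv_into_into)
  have b': "b' \<in> carrier G" "\<pi> b' = \<pi> b"
    using assms by (auto simp: b'_def f_inv_into_f inv_into_into)
  have "\<pi> (a \<otimes>\<^bsub>A\<^esub> b) = \<pi> (a' \<otimes>\<^bsub>A\<^esub> b)"
    using assms a' by (intro permutation_proj_add_left) auto
  also have "\<dots> = \<pi> (b \<otimes>\<^bsub>A\<^esub> a')"
    using assms a' by (simp add: A.m_comm carrier_A)
  also have "\<dots> = \<pi> (b' \<otimes>\<^bsub>A\<^esub> a')"
    using assms a' b' by (intro permutation_proj_add_left) auto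
  also have "\<dots> = \<pi> (a' \<otimes>\<^bsub>A\<^esub> b')"
    using a' b' by (simp add: A.m_comm carrier_A)
  finally show ?thesis
    by (simp add: permutation_add_group_def Let_def a'_def b'_def)
qed

lemma carrier_Q: "carrier Q = carrier \<G>" and one_Q: "\<one>\<^bsub>Q\<^esub> = \<one>\<^bsub>\<G>\<^esub>"
  by (simp_all add: permutation_add_group_def Let_def)

lemma permutation_proj_hom_add: "\<pi> \<in> hom A Q"
  by (rule homI) (auto simp: carrier_A carrier_Q permutation_proj_add)

sublocale Q: comm_group Q
proof -
  have "comm_group (Q\<lparr>carrier := \<pi> ` carrier A, one := \<pi> \<one>\<^bsub>A\<^esub>\<rparr>)"
    by (rule A.hom_imp_img_comm_group[OF permutation_proj_hom_add])
  moreover have "\<pi> ` carrier A = carrier Q" "\<pi> \<one>\<^bsub>A\<^esub> = \<one>\<^bsub>Q\<^esub>"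
    using permutation_proj_image by (simp_all add: carrier_A carrier_Q one_Q flip: B.one_eq)
  ultimately show "comm_group Q" by simp
qed

sublocale \<pi>_add: group_hom A Q \<pi>
  by unfold_locales (rule permutation_proj_hom_add)

lemma brace_permutation: "brace Q \<G>"
proof -
  have "g \<otimes>\<^bsub>\<G>\<^esub> (h \<otimes>\<^bsub>Q\<^esub> k) = (g \<otimes>\<^bsub>\<G>\<^esub> h) \<otimes>\<^bsub>Q\<^esub> inv\<^bsub>Q\<^esub> g \<otimes>\<^bsub>Q\<^esub> (g \<otimes>\<^bsub>\<G>\<^esub> k)"
    if g: "g \<in> carrier \<G>" and h: "h \<in> carrier \<G>" and k: "k \<in> carrier \<G>" for g h k
  proof -
    have surj: "\<exists>a\<in>carrier G. g = \<pi> a" if "g \<in> carrier \<G>" for g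
      using that unfolding permutation_proj_image[symmetric] by (rule imageE) (rule bexI)
    obtain a b c where abc: "a \<in> carrier G" "b \<in> carrier G" "c \<in> carrier G"
      and ghk: "g = \<pi> a" "h = \<pi> b" "k = \<pi> c"
      using surj[OF g] surj[OF h] surj[OF k] by metis
    have inv: "inv\<^bsub>A\<^esub> a \<in> carrier G" using abc B.additive.inv_closed[of a] by (simp add: carrier_A)
    have add: "x \<otimes>\<^bsub>A\<^esub> y \<in> carrier G" if "x \<in> carrier G" "y \<in> carrier G" for x y
      using B.additive.m_closed[of x y] that by (simp add: carrier_A)
    have "\<pi> (a \<otimes>\<^bsub>G\<^esub> (b \<otimes>\<^bsub>A\<^esub> c)) = \<pi> ((a \<otimes>\<^bsub>G\<^esub> b) \<otimes>\<^bsub>A\<^esub> inv\<^bsub>A\<^esub> a \<otimes>\<^bsub>A\<^esub> (a \<otimes>\<^bsub>G\<^esub> c))"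
      using abc by (simp add: B.skew_distrib carrier_A)
    then show ?thesis
      using abc inv by (simp add: ghk permutation_proj_add add \<pi>_add.hom_inv carrier_A)
  qed
  then have "skew_brace Q \<G>"
    by unfold_locales (auto simp: carrier_Q)
  then show ?thesis by (simp add: brace_def Q.comm_group_axioms)
qed

sublocale P: skew_brace Q \<G>
  using brace_permutation by (simp add: brace_def)

lemma permutation_proj_gamma:
  assumes "a \<in> carrier G" "b \<in> carrier G"
  shows "\<pi> (gamma A G a b) = gamma Q \<G> (\<pi> a) (\<pi> b)"
proof -
  have "inv\<^bsub>A\<^esub> a \<in> carrier G" using assms B.additive.inv_closed[of a] by (simp add: carrier_A)
  then show ?thesis
    using assms by (simp add: gamma_def permutation_proj_add \<pi>_add.hom_inv carrier_A)
qed

text \<open>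
  The common form of the three conditions: \<open>\<pi>\<close> does not see the action of \<open>\<gamma>\<close>.
\<close>

definition gamma_invariant :: bool where
  "gamma_invariant \<longleftrightarrow> (\<forall>a\<in>carrier G. \<forall>b\<in>carrier G. \<pi> (gamma A G a b) = \<pi> b)"

lemma bi_skew_brace_structure_iff: "bi_skew_brace A G \<longleftrightarrow> gamma_invariant"
  unfolding bi_skew_brace_iff_gamma_invariant[OF brace_structure] gamma_invariant_def carrier_A
  using permutation_proj_eq_iff B.gamma_closed by (simp add: carrier_A)

lemma trivial_brace_permutation_iff: "trivial_brace Q \<G> \<longleftrightarrow> gamma_invariant"
proof -
  have "trivial_brace Q \<G> \<longleftrightarrow> (\<forall>a\<in>carrier G. \<forall>b\<in>carrier G. \<pi> a \<otimes>\<^bsub>Q\<^esub> \<pi> b = \<pi> a \<otimes>\<^bsub>\<G>\<^esub> \<pi> b)"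
    unfolding trivial_brace_def carrier_Q permutation_proj_image[symmetric]
    by (simp add: brace_permutation)
  also have "\<dots> \<longleftrightarrow> (\<forall>a\<in>carrier G. \<forall>b\<in>carrier G. \<pi> a \<otimes>\<^bsub>Q\<^esub> \<pi> b = \<pi> a \<otimes>\<^bsub>Q\<^esub> \<pi> (gamma A G a b))"
    by (simp add: P.mult_gamma carrier_Q permutation_proj_gamma)
  also have "\<dots> \<longleftrightarrow> gamma_invariant"
  proof -
    have "\<pi> (gamma A G a b) \<in> carrier Q" if "a \<in> carrier G" "b \<in> carrier G" for a b
      using that B.gamma_closed by (simp add: carrier_A carrier_Q)
    then show ?thesis by (auto simp: gamma_invariant_def carrier_Q)
  qed
  finally show ?thesis .
qed

text \<open>
  For fixed \<open>a\<close>, both \<open>\<pi> \<circ> \<gamma>(a)\<close> and \<open>\<pi>\<close> are homomorphisms of the additive groups, so it suffices to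
  compare them on \<open>\<iota> ` X\<close>; there \<open>a\<close> acts through \<open>left_action\<close> and can be built up from letters.
\<close>

lemma gamma_invariant_if_generators:
  assumes "\<And>x y. x \<in> X \<Longrightarrow> y \<in> X \<Longrightarrow> \<pi> (\<iota> (\<sigma> x y)) = \<pi> (\<iota> y)"
  shows gamma_invariant
  unfolding gamma_invariant_def
proof (intro ballI)
  fix a b assume a: "a \<in> carrier G" and b: "b \<in> carrier G"
  have generators: "\<pi> (\<iota> (left_action a y)) = \<pi> (\<iota> y)" if "y \<in> X" for y
    using a that
  proof (induction arbitrary: y rule: structure_group_induct)
    case (inv x)
    let ?y' = "left_action (inv\<^bsub>G\<^esub> \<iota> x) y"
    have "\<pi> (\<iota> ?y') = \<pi> (\<iota> (left_action (\<iota> x) ?y'))"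
      using inv by (intro inv(2)[symmetric]) simp
    then show ?case using inv by (simp del: action_iota)
  qed (auto simp: assms)
  have "(\<pi> \<circ> gamma A G a) \<in> hom A Q"
    using a by (intro hom_compose[OF B.gamma_hom permutation_proj_hom_add]) (simp add: carrier_A)
  then have "(\<pi> \<circ> gamma A G a) b = \<pi> b"
    by (rule hom_eq_on_iota[OF Q.is_group _ permutation_proj_hom_add _ b])
      (use a generators in \<open>simp add: gamma_action\<close>)
  then show "\<pi> (gamma A G a b) = \<pi> b" by simp
qed

lemma trivial_solution_retract_iff:
  "trivial_solution (retract_set X r) (retract_map X r) \<longleftrightarrow> gamma_invariant"
proof
  assume "trivial_solution (retract_set X r) (retract_map X r)"
  then have "gamma Q \<G> (\<pi> (\<iota> x)) (\<pi> (\<iota> y)) = \<pi> (\<iota> y)" if "x \<in> X" "y \<in> X" for x y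
    using that by (simp add: trivial_solution_def retract_set_def retract_map_def brace_solution_def)
  then show gamma_invariant
    by (intro gamma_invariant_if_generators) (simp add: permutation_proj_gamma flip: gamma_iota)
next
  assume inv: gamma_invariant
  then have "trivial_brace Q \<G>" by (simp add: trivial_brace_permutation_iff)
  then have comm: "g \<otimes>\<^bsub>\<G>\<^esub> h = h \<otimes>\<^bsub>\<G>\<^esub> g" if "g \<in> carrier \<G>" "h \<in> carrier \<G>" for g h
    using that Q.m_comm[of g h] by (simp add: trivial_brace_def carrier_Q)
  have "brace_solution Q \<G> (\<pi> a, \<pi> b) = (\<pi> b, \<pi> a)" if "a \<in> carrier G" "b \<in> carrier G" for a b
  proof -
    have "gamma Q \<G> (\<pi> a) (\<pi> b) = \<pi> b"
      using inv that by (simp add: gamma_invariant_def flip: permutation_proj_gamma)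
    moreover have "inv\<^bsub>\<G>\<^esub> \<pi> b \<otimes>\<^bsub>\<G>\<^esub> \<pi> a \<otimes>\<^bsub>\<G>\<^esub> \<pi> b = \<pi> a"
      using that comm[of "\<pi> a" "\<pi> b"] by (simp add: \<G>.m_assoc flip: \<G>.m_assoc[of _ "\<pi> b"])
    ultimately show ?thesis by (simp add: brace_solution_def)
  qed
  then show "trivial_solution (retract_set X r) (retract_map X r)"
    using nonempty
    by (intro trivial_solution_flip) (auto simp: retract_set_def retract_map_def)
qed

end

theorem proposition5p6:
  fixes X :: "'a set" and r :: "'a \<times> 'a \<Rightarrow> 'a \<times> 'a"
  assumes "involutive_solution X r"
  shows "(bi_skew_brace (structure_add_group X r) (structure_group X r) \<longleftrightarrow>
            trivial_brace (permutation_add_group X r) (permutation_group X r)) \<and>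
         (trivial_brace (permutation_add_group X r) (permutation_group X r) \<longleftrightarrow>
            trivial_solution (retract_set X r) (retract_map X r))"
proof -
  interpret involutive X r
    using assms by (auto simp: involutive_solution_def involutive_def involutive_axioms_def)
  show ?thesis
    by (simp add: bi_skew_brace_structure_iff trivial_brace_permutation_iff
        trivial_solution_retract_iff)
qed

end
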